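(* Let $\{Y_1,\dots,Y_n\}\subset\mathbb{M}_d$ be an independent sequence of random matrices, and form the product $Z_n=Y_n\cdots Y_1$. Assume that $$\|\mathbb{E}Y_i\|\le m_i\quad\text{and}\quad\big(\mathbb{E}\|Y_i-\mathbb{E}Y_i\|^2\big)^{1/2}\le\sigma_im_i\quad\text{for } i=1,\dots,n.$$ Let $M=\prod_{i=1}^nm_i$ and $v=\sum_{i=1}^n\sigma_i^2$. Then $$\mathbb{E}\|Z_n\|\le\exp\Big(\sqrt{2v\,(2v\vee\log d)}\Big)\cdot M.$$ Provided that $v\,(1+2\log d)\le1$, then also $$\mathbb{E}\|Z_n-\mathbb{E}Z_n\|\le\sqrt{e^2v\,(1+2\log d)}\cdot M.$$
   Context: $\mathbb{M}_d$ is the algebra of $d\times d$ complex matrices, $\|\cdot\|$ is the spectral norm ($\ell_2$ operator norm), and $a\vee b=\max\{a,b\}$. $e$ is Euler's number. *)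

theory Defs
  imports "HOL-Probability.Probability"
begin

(* The norm on complex ^ 'd is the l2 norm.  The type class norm of a matrix in
   complex ^ 'd ^ 'd is the Frobenius norm, so it is not used for the spectral norm. *)
definition spectral_norm :: "complex ^ 'd ^ 'd \<Rightarrow> real" where
  "spectral_norm A = onorm ((*v) A)"

(* A n ** ... ** A 1: later factors act on the left; A 0 is not used. *)
primrec left_prod :: "(nat \<Rightarrow> complex ^ 'd ^ 'd) \<Rightarrow> nat \<Rightarrow> complex ^ 'd ^ 'd" where
  "left_prod A 0 = mat 1"
| "left_prod A (Suc k) = A (Suc k) ** left_prod A k"

end

theory Submission
  imports Defs "HOL-Real_Asymp.Real_Asymp"
begin

text \<open>
  Let \<open>p = 2k\<close>.  The squared Schatten \<open>p\<close>-norm is 2-smooth with constant \<open>p - 1\<close>, and it is equivalent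
  to the squared spectral norm up to the factor \<open>d powr (2/p)\<close>.  Split
  \<open>Z\<^sub>j - E Z\<^sub>j = E Y\<^sub>j ** (Z\<^sub>j\<^sub>-\<^sub>1 - E Z\<^sub>j\<^sub>-\<^sub>1) + (Y\<^sub>j - E Y\<^sub>j) ** Z\<^sub>j\<^sub>-\<^sub>1\<close>.  Conditionally on \<open>Z\<^sub>j\<^sub>-\<^sub>1\<close> the
  second term has mean zero, so smoothness gives a recursion for the second moments of the Schatten
  norm; the uncentred case is analogous.  The bound is optimized over \<open>p\<close>; even integer
  exponents suffice, since the bound \<open>p - 1\<close> leaves enough room compared with \<open>p\<close>.  Smoothness
  follows from a two-point inequality, which reduces to the scalar case by Hoelder's inequality for
  traces of words of length \<open>p\<close>.
\<close>

subsection \<open>Schatten norms with even exponent\<close>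

definition adj :: "complex ^ 'd ^ 'd \<Rightarrow> complex ^ 'd ^ 'd" where
  "adj A = (\<chi> i j. cnj (A $ j $ i))"

lemma adj_adj [simp]: "adj (adj A) = A"
  by (simp add: adj_def vec_eq_iff)

lemma adj_zero [simp]: "adj 0 = 0"
  by (simp add: adj_def vec_eq_iff)

lemma adj_mat_1 [simp]: "adj (mat 1) = mat 1"
  by (auto simp: adj_def vec_eq_iff mat_def)

lemma adj_add: "adj (A + B) = adj A + adj B"
  by (simp add: adj_def vec_eq_iff)

lemma adj_diff: "adj (A - B) = adj A - adj B"
  by (simp add: adj_def vec_eq_iff)

lemma adj_scaleR: "adj (c *\<^sub>R A) = c *\<^sub>R adj A"
  by (simp add: adj_def vec_eq_iff)

lemma adj_mult: "adj (A ** B) = adj B ** adj A"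
  by (simp add: adj_def vec_eq_iff matrix_matrix_mult_def mult.commute)

lemma bounded_linear_adj: "bounded_linear adj"
  by (simp add: linear_conv_bounded_linear[symmetric] linear_iff adj_add adj_scaleR)

lemma norm_matrix_power2: "(norm A)\<^sup>2 = (\<Sum>i\<in>UNIV. \<Sum>j\<in>UNIV. (cmod (A $ i $ j))\<^sup>2)"
  by (simp add: norm_vec_def L2_set_def sum_nonneg)

lemma norm_adj [simp]: "norm (adj A) = norm A"
proof -
  have "(norm (adj A))\<^sup>2 = (norm A)\<^sup>2"
    by (simp add: norm_matrix_power2 adj_def) (rule sum.swap)
  then show ?thesis
    by simp
qed

lemma adj_eq_0_iff [simp]: "adj A = 0 \<longleftrightarrow> A = 0"
  by (metis adj_adj adj_zero)

lemma trace_adj_mult: "trace (A ** adj A) = of_real ((norm A)\<^sup>2)"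
  by (simp add: norm_matrix_power2 trace_def matrix_matrix_mult_def adj_def
      complex_norm_square[symmetric])

text \<open>\<open>trace (A ** B)\<close> is the Frobenius inner product of \<open>A\<close> and
  \<open>adj B\<close>, so the Cauchy-Schwarz inequality applies to the two families of
  entries.\<close>

lemma trace_mult_Cauchy_Schwarz: "cmod (trace (A ** B)) \<le> norm A * norm (B :: complex^'d^'d)"
proof -
  have L2: "L2_set (\<lambda>(i,j). cmod (C $ i $ j)) (UNIV\<times>UNIV) = norm C" for C :: "complex^'d^'d"
  proof -
    have "L2_set (\<lambda>(i,j). cmod (C $ i $ j)) (UNIV\<times>UNIV) = sqrt ((norm C)\<^sup>2)"
      unfolding norm_matrix_power2 by (simp add: L2_set_def case_prod_beta sum.cartesian_product)
    then show ?thesis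
      by simp
  qed
  have "cmod (trace (A ** B)) \<le> (\<Sum>(i,j)\<in>UNIV\<times>UNIV. cmod (A $ i $ j) * cmod (adj B $ i $ j))"
    by (auto simp: trace_def matrix_matrix_mult_def adj_def sum.cartesian_product norm_mult
        intro!: sum_norm_le)
  also have "\<dots> \<le> L2_set (\<lambda>(i,j). cmod (A $ i $ j)) (UNIV\<times>UNIV)
      * L2_set (\<lambda>(i,j). cmod (adj B $ i $ j)) (UNIV\<times>UNIV)"
    using L2_set_mult_ineq[of "\<lambda>(i,j). cmod (A $ i $ j)" "\<lambda>(i,j). cmod (adj B $ i $ j)" "UNIV\<times>UNIV"]
    by (simp add: case_prod_beta)
  finally show ?thesis
    unfolding L2 norm_adj .
qed

lemma trace_add_complex: "trace (A + B) = trace A + trace (B :: complex^'d^'d)"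
  by (simp add: trace_def sum.distrib)

lemma trace_diff_complex: "trace (A - B) = trace A - trace (B :: complex^'d^'d)"
  by (simp add: trace_def sum_subtractf)

lemma trace_scaleR_complex: "trace (c *\<^sub>R A) = of_real c * trace (A :: complex^'d^'d)"
  by (simp add: trace_def scaleR_conv_of_real[where 'a = complex] sum_distrib_left)

lemma bounded_bilinear_matrix_mult:
  "bounded_bilinear ((**) :: complex^'d^'d \<Rightarrow> complex^'d^'d \<Rightarrow> complex^'d^'d)"
  unfolding bilinear_conv_bounded_bilinear[symmetric] bilinear_def linear_iff
  by (auto simp: vec_eq_iff matrix_matrix_mult_def algebra_simps sum.distrib scaleR_sum_right)

lemmas matrix_mult_bilinear_simps =
  bounded_bilinear.add_left[OF bounded_bilinear_matrix_mult]
  bounded_bilinear.add_right[OF bounded_bilinear_matrix_mult]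
  bounded_bilinear.diff_left[OF bounded_bilinear_matrix_mult]
  bounded_bilinear.diff_right[OF bounded_bilinear_matrix_mult]
  bounded_bilinear.scaleR_left[OF bounded_bilinear_matrix_mult]
  bounded_bilinear.scaleR_right[OF bounded_bilinear_matrix_mult]

section \<open>Words of matrices, their rotations and reflections\<close>

definition mprod :: "(complex ^ 'd ^ 'd) list \<Rightarrow> complex ^ 'd ^ 'd" where
  "mprod l = foldr (**) l (mat 1)"

lemma mprod_Nil [simp]: "mprod [] = mat 1"
  by (simp add: mprod_def)

lemma mprod_Cons [simp]: "mprod (A # l) = A ** mprod l"
  by (simp add: mprod_def)

lemma mprod_append: "mprod (l @ l') = mprod l ** mprod l'"
  by (induction l) (simp_all add: matrix_mul_assoc)

lemma mprod_rotate: "trace (mprod (l @ l')) = trace (mprod (l' @ l))"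
  unfolding mprod_append by (rule trace_mul_sym)

lemma adj_mprod: "adj (mprod l) = mprod (rev (map adj l))"
  by (induction l) (simp_all add: adj_mult mprod_append)

lemma mprod_eq_0: "0 \<in> set l \<Longrightarrow> mprod l = 0"
  by (induction l) auto

text \<open>For even length the product of this word is a power of \<open>A ** adj A\<close>, yet
  every letter is real linear in \<open>A\<close>, which allows expansion letter by letter.\<close>

fun alt :: "complex ^ 'd ^ 'd \<Rightarrow> nat \<Rightarrow> (complex ^ 'd ^ 'd) list" where
  "alt A 0 = []"
| "alt A (Suc n) = A # alt (adj A) n"

lemma length_alt [simp]: "length (alt A n) = n"
  by (induction n arbitrary: A) auto

lemma alt_add: "alt A (m + n) = alt A m @ alt ((adj ^^ m) A) n"
  by (induction m arbitrary: A) (simp_all add: funpow_swap1)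

text \<open>Reflection preserves alternation; the parity of \<open>n\<close> decides the new first
  letter, hence the iterate \<open>adj ^^ n\<close>.\<close>

lemma rev_adj_alt: "rev (map adj (alt A n)) = alt ((adj ^^ n) A) n"
proof (induction n arbitrary: A)
  case (Suc n)
  have "rev (map adj (alt A (Suc n))) = alt ((adj ^^ n) (adj A)) n @ [adj A]"
    by (simp add: Suc.IH)
  also have "\<dots> = alt ((adj ^^ n) (adj A)) (n + 1)"
  proof -
    have "(adj ^^ n) ((adj ^^ n) B) = B" for B :: "complex^'a^'a"
      by (induction n) (simp_all add: funpow_swap1)
    then show ?thesis
      unfolding alt_add by simp
  qed
  finally show ?case
    by (simp add: funpow_swap1)
qed simp

text \<open>By \<open>rev_adj_alt\<close> the reflection begins with exactly the letter that
  continues the alternation after \<open>n\<close> letters. The doubling of runs rests on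
  this.\<close>

lemma alt_self_adjoint: "alt A n @ rev (map adj (alt A n)) = alt A (2 * n)"
  by (simp add: rev_adj_alt mult_2 alt_add)

text \<open>Moving the first letter of \<open>alt A (2 * n)\<close> to the end keeps the word
  alternating, and the trace is cyclic.\<close>

lemma alt_rotate: "trace (mprod (alt (adj A) (2 * n))) = trace (mprod (alt A (2 * n)))"
proof (cases n)
  case (Suc m)
  have "(adj ^^ Suc (2 * m)) (adj A) = A"
    by (induction m) auto
  then have "alt (adj A) (Suc (2 * m) + 1) = alt (adj A) (Suc (2 * m)) @ [A]"
    unfolding alt_add by simp
  then show ?thesis
    using mprod_rotate[of "[A]" "alt (adj A) (Suc (2 * m))"] Suc by simp
qed simp

lemma trace_alt: "trace (mprod (alt A (2 * n))) = of_real ((norm (mprod (alt A n)))\<^sup>2)"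
  by (simp add: alt_self_adjoint[symmetric] mprod_append adj_mprod[symmetric] trace_adj_mult)

lemma norm_alt_adj: "norm (mprod (alt (adj A) n)) = norm (mprod (alt A n))"
proof -
  have "(norm (mprod (alt (adj A) n)))\<^sup>2 = (norm (mprod (alt A n)))\<^sup>2"
    using alt_rotate[of A n] by (simp only: trace_alt of_real_eq_iff)
  then show ?thesis
    by simp
qed

text \<open>Let \<open>j\<close> be \<open>n / 2\<close> rounded up. If the word of length
  \<open>n\<close> vanishes, so does the one of length \<open>2 * j\<close>, whose trace is the
  squared Frobenius norm of the word of length \<open>j < n\<close>.\<close>

lemma mprod_alt_eq_0: "n \<ge> 1 \<Longrightarrow> mprod (alt A n) = 0 \<Longrightarrow> A = 0"
proof (induction n rule: less_induct)
  case (less n)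
  show ?case
  proof (cases "n = 1")
    case False
    obtain j i where j: "j < n" "1 \<le> j" "2 * j = n + i"
    proof
      show "n - n div 2 < n" "1 \<le> n - n div 2"
        using False less.prems(1) by linarith+
      show "2 * (n - n div 2) = n + n mod 2"
        by presburger
    qed
    have "mprod (alt A (2 * j)) = 0"
      unfolding j(3) by (simp add: alt_add mprod_append less.prems)
    then have "complex_of_real ((norm (mprod (alt A j)))\<^sup>2) = 0"
      unfolding trace_alt[symmetric] by (simp add: trace_def)
    then have "mprod (alt A j) = 0"
      by simp
    then show ?thesis
      using less.IH j by blast
  qed (use less.prems in simp)
qed

text \<open>The square of the inner norm is the trace of the \<open>k\<close>-th power of
  \<open>A ** adj A\<close>, so this is the Schatten norm of exponent \<open>2 * k\<close>, not
  \<open>k\<close>; the Frobenius norm is the case \<open>k = 1\<close>.\<close>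

definition schatten :: "nat \<Rightarrow> complex ^ 'd ^ 'd \<Rightarrow> real" where
  "schatten k A = root k (norm (mprod (alt A k)))"

lemma schatten_nonneg [simp]: "k \<ge> 1 \<Longrightarrow> schatten k A \<ge> 0"
  by (simp add: schatten_def)

lemma schatten_power: "k \<ge> 1 \<Longrightarrow> schatten k A ^ k = norm (mprod (alt A k))"
  by (simp add: schatten_def)

lemma schatten_eq_0_iff: "k \<ge> 1 \<Longrightarrow> schatten k A = 0 \<longleftrightarrow> A = 0"
  using mprod_alt_eq_0[of k A] mprod_eq_0[of "alt A k"]
  by (cases k) (auto simp: schatten_def)

lemma schatten_pos: "k \<ge> 1 \<Longrightarrow> A \<noteq> 0 \<Longrightarrow> schatten k A > 0"
  using schatten_eq_0_iff[of k A] schatten_nonneg[of k A] by linarith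

lemma schatten_adj [simp]: "schatten k (adj A) = schatten k A"
  by (simp add: schatten_def norm_alt_adj)

lemma trace_alt_schatten: "k \<ge> 1 \<Longrightarrow> trace (mprod (alt A (2 * k))) = of_real (schatten k A ^ (2 * k))"
  by (simp add: trace_alt schatten_power power_even_eq)

lemma norm_mprod_power2: "(norm (mprod l))\<^sup>2 = cmod (trace (mprod (l @ rev (map adj l))))"
  by (simp add: mprod_append adj_mprod[symmetric] trace_adj_mult norm_power)

text \<open>Splitting the word gives a product of two Frobenius norms, and each squared norm is the
  trace of one part joined to its mirror image. This is the reflection step of the chessboard
  argument.\<close>

lemma trace_mprod_Cauchy_Schwarz:
  "(cmod (trace (mprod (l @ l'))))\<^sup>2
    \<le> cmod (trace (mprod (l @ rev (map adj l)))) * cmod (trace (mprod (rev (map adj l') @ l')))"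
proof -
  have "(cmod (trace (mprod (l @ l'))))\<^sup>2 \<le> (norm (mprod l) * norm (mprod l'))\<^sup>2"
    unfolding mprod_append by (intro power_mono trace_mult_Cauchy_Schwarz) auto
  also have "norm (mprod l') = norm (mprod (rev (map adj l')))"
    by (metis adj_mprod norm_adj)
  finally show ?thesis
    by (simp add: power_mult_distrib norm_mprod_power2 rev_map comp_def)
qed

text \<open>
  Chessboard argument: among the words of length \<open>2k\<close> in the given letters and their adjoints take
  one that maximizes the ratio of the two sides.  By Cauchy-Schwarz, reflecting one half of a
  maximizer gives another maximizer, and this doubles the length of an alternating run, until the
  whole word alternates.  For an alternating word the ratio is 1.
\<close>
theorem trace_mprod_le:
  fixes l :: "(complex ^ 'd ^ 'd) list"
  assumes k: "k \<ge> 1" and len: "length l = 2 * k"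
  shows "cmod (trace (mprod l)) \<le> prod_list (map (schatten k) l)"
proof (cases "0 \<in> set l")
  case True
  have "0 \<le> prod_list (map (schatten k) l)"
    by (rule prod_list_nonneg) (use k in auto)
  then show ?thesis
    using True by (simp add: mprod_eq_0 trace_def)
next
  case False
  \<comment> \<open>Adjoints are included so that reflected words stay in the finite set
    \<open>W\<close>, on which \<open>r\<close> attains its maximum.\<close>
  define S where "S = set l \<union> adj ` set l"
  define W where "W = {l. set l \<subseteq> S \<and> length l = 2 * k}"
  define r where "r = (\<lambda>l :: (complex ^ 'd ^ 'd) list. cmod (trace (mprod l)) / prod_list (map (schatten k) l))"
  have fin: "finite W"
    unfolding W_def by (rule finite_lists_length_eq) (simp add: S_def)
  have lW: "l \<in> W"
    by (auto simp: W_def S_def len)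
  have S0: "0 \<notin> S"
    using False by (auto simp: S_def)
  have Sadj: "adj A \<in> S" if "A \<in> S" for A
    using that by (auto simp: S_def)
  have pos: "prod_list (map (schatten k) w) > 0" if "set w \<subseteq> S" for w
    using that S0 k by (induction w) (auto intro!: mult_pos_pos schatten_pos)
  have "Max (r ` W) \<in> r ` W"
    by (rule Max_in) (use fin lW in auto)
  then obtain w0 where w0: "w0 \<in> W" "r w0 = Max (r ` W)"
    by auto
  define K where "K = r w0"
  have le: "r w \<le> K" if "w \<in> W" for w
    using w0 fin that by (simp add: K_def)
  have rotate: "r (w @ w') = r (w' @ w)" for w w'
    by (simp add: r_def mprod_rotate[of w w'] mult.commute)
  have refl: "r (w @ w') ^ 2 \<le> r (w @ rev (map adj w)) * r (rev (map adj w') @ w')"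
    if "set w \<subseteq> S" "set w' \<subseteq> S" for w w'
  proof -
    have rv: "prod_list (map (schatten k) (rev (map adj v))) = prod_list (map (schatten k) v)" for v
      by (simp add: rev_map[symmetric] comp_def)
    have "r (w @ w') ^ 2 = (cmod (trace (mprod (w @ w'))))\<^sup>2
        / (prod_list (map (schatten k) w) * prod_list (map (schatten k) w')) ^ 2"
      by (simp add: r_def power_divide)
    also have "\<dots> \<le> cmod (trace (mprod (w @ rev (map adj w)))) * cmod (trace (mprod (rev (map adj w') @ w')))
        / (prod_list (map (schatten k) w) * prod_list (map (schatten k) w')) ^ 2"
      by (intro divide_right_mono trace_mprod_Cauchy_Schwarz) auto
    also have "\<dots> = r (w @ rev (map adj w)) * r (rev (map adj w') @ w')"
      unfolding r_def map_append prod_list.append rv by (simp add: power2_eq_square)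
    finally show ?thesis .
  qed
  \<comment> \<open>Rotation puts the run at the end of the half \<open>C @ alt A j\<close>, and
    reflecting this half continues the run to length \<open>2 * j\<close>. The other half
    \<open>B\<close> is reflected too and gives a ratio of at most \<open>K\<close>, so one factor
    \<open>K\<close> cancels.\<close>
  have double: "\<exists>w. w \<in> W \<and> r w = K \<and> take (2 * j) w = alt A (2 * j)"
    if K0: "K > 0" and j: "j \<le> k" and w: "w \<in> W" "r w = K" "take j w = alt A j" for j A w
  proof -
    define B where "B = take k (drop j w)"
    define C where "C = drop k (drop j w)"
    have w_eq: "w = alt A j @ B @ C"
      unfolding B_def C_def append_take_drop_id w(3)[symmetric] by simp
    have lens: "length B = k" "length C = k - j"
      using w(1) j by (auto simp: B_def C_def W_def)
    have sub: "set (alt A j) \<subseteq> S" "set B \<subseteq> S" "set C \<subseteq> S"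
      using w(1) unfolding w_eq W_def by auto
    let ?U = "C @ alt A j"
    have U: "set (?U @ rev (map adj ?U)) \<subseteq> S" and B': "set (rev (map adj B) @ B) \<subseteq> S"
      using sub Sadj by auto
    have UW: "?U @ rev (map adj ?U) \<in> W"
      using U lens j by (auto simp: W_def)
    have BW: "rev (map adj B) @ B \<in> W"
      using B' lens j by (auto simp: W_def)
    have "r (?U @ B) = K"
      using w(2) rotate[of "alt A j @ B" C] unfolding w_eq by simp
    then have "K ^ 2 \<le> r (?U @ rev (map adj ?U)) * r (rev (map adj B) @ B)"
      using refl[of ?U B] sub by simp
    also have "\<dots> \<le> r (?U @ rev (map adj ?U)) * K"
      by (intro mult_left_mono le BW) (auto simp: r_def intro!: divide_nonneg_pos pos[OF U, simplified])
    finally have "K \<le> r (?U @ rev (map adj ?U))"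
      using K0 by (simp add: power2_eq_square)
    then have "r (?U @ rev (map adj ?U)) = K"
      using le[OF UW] by simp
    moreover have "?U @ rev (map adj ?U) = C @ (alt A (2 * j) @ rev (map adj C))"
      by (simp add: alt_self_adjoint[symmetric])
    ultimately have "r ((alt A (2 * j) @ rev (map adj C)) @ C) = K"
      using rotate[of C "alt A (2 * j) @ rev (map adj C)"] by (simp only:)
    moreover have "(alt A (2 * j) @ rev (map adj C)) @ C \<in> W"
      using UW unfolding W_def by (auto simp: alt_self_adjoint[symmetric])
    ultimately show ?thesis
      by (intro exI[of _ "(alt A (2 * j) @ rev (map adj C)) @ C"]) auto
  qed
  have "K \<le> 1"
  proof (cases "K > 0")
    case K0: True
    define A where "A = hd w0"
    have "\<exists>w. w \<in> W \<and> r w = K \<and> take j w = alt A j" if "1 \<le> j" "j \<le> k" for j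
      using that
    proof (induction j rule: dec_induct)
      case base
      have "w0 \<noteq> []"
        using w0(1) k by (auto simp: W_def)
      then show ?case
        using w0 by (intro exI[of _ w0]) (auto simp: K_def A_def take_Suc)
    next
      case (step j)
      \<comment> \<open>The run of \<open>2 * j\<close> letters covers the \<open>Suc j\<close>
        letters that are needed.\<close>
      then obtain w where w: "w \<in> W" "r w = K" "take (2 * j) w = alt A (2 * j)"
        using double[OF K0, of j] by (meson Suc_leD)
      have "2 * j = Suc j + (j - 1)"
        using step by simp
      then have "take (Suc j) (alt A (2 * j)) = alt A (Suc j)"
        by (metis alt_add append_eq_conv_conj length_alt)
      moreover have "take (Suc j) (take (2 * j) w) = take (Suc j) w"
        using step by (simp add: min_def)
      ultimately show ?case
        using w by metis
    qed
    from this[of k] obtain w where "w \<in> W" "r w = K" "take k w = alt A k"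
      using k by auto
    \<comment> \<open>One more doubling, at \<open>j = k\<close>, fills the whole word.\<close>
    from double[OF K0 _ this] obtain w where w: "w \<in> W" "r w = K" "take (2 * k) w = alt A (2 * k)"
      by auto
    then have w_eq: "w = alt A (2 * k)"
      by (simp add: W_def)
    have "map (schatten k) (alt A n) = replicate n (schatten k A)" for n and A :: "complex^'d^'d"
      by (induction n arbitrary: A) auto
    then have "r w = schatten k A ^ (2 * k) / schatten k A ^ (2 * k)"
      unfolding r_def w_eq using k by (simp add: trace_alt_schatten norm_power)
    then show ?thesis
      using w by simp
  qed simp
  then have "r l \<le> 1"
    using le[OF lW] by simp
  then show ?thesis
    using pos[of l] unfolding r_def by (simp add: S_def divide_simps split: if_splits)
qed

subsection \<open>Uniform smoothness\<close>

text \<open>Comparing quotients of consecutive coefficients reduces the claim to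
  \<open>2k - 2j - 1 \<le> (2k - 1)(2j + 1)\<close>.\<close>

lemma binomial_even_le: "real ((2 * k) choose (2 * j)) \<le> real (k choose j) * (2 * real k - 1) ^ j"
proof (induction j)
  case (Suc j)
  show ?case
  proof (cases "j < k")
    case True
    have step: "(N choose Suc i) * Suc i = (N choose i) * (N - i)" for N i
      using binomial_absorb_comp[of N i] binomial_absorption[of i N] by (metis mult.commute)
    have two: "((2 * k) choose (2 * Suc j)) * ((2 * j + 2) * (2 * j + 1))
        = ((2 * k) choose (2 * j)) * ((2 * k - 2 * j) * (2 * k - 2 * j - 1))"
    proof -
      have aux: "a * (s * t) = c * (p * q)" if "a * s = b * q" "b * t = c * p" for a b c p q s t :: nat
        using that by algebra
      show ?thesis
        by (rule aux[where b = "(2 * k) choose Suc (2 * j)"])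
          (use step[of "2 * k" "2 * j"] step[of "2 * k" "Suc (2 * j)"] in simp_all)
    qed
    have one: "(k choose Suc j) * (j + 1) = (k choose j) * (k - j)"
      using step[of k j] by simp
    have nn: "2 * real k - 1 \<ge> 0"
      using True by simp
    have two': "real ((2 * k) choose (2 * Suc j)) * ((2 * real j + 2) * (2 * real j + 1))
        = real ((2 * k) choose (2 * j)) * (2 * (real k - real j) * (2 * real k - 2 * real j - 1))"
    proof -
      have "real (2 * k - 2 * j) = 2 * (real k - real j)"
        "real (2 * k - 2 * j - 1) = 2 * real k - 2 * real j - 1"
        "real (2 * j + 2) = 2 * real j + 2" "real (2 * j + 1) = 2 * real j + 1"
        using True by (simp_all add: of_nat_diff)
      then show ?thesis
        using arg_cong[OF two, of real] by (simp only: of_nat_mult)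
    qed
    have one': "real (k choose Suc j) * (real j + 1) = real (k choose j) * (real k - real j)"
      using arg_cong[OF one, of real] True by (simp add: of_nat_diff distrib_left)
    have le: "2 * real k - 2 * real j - 1 \<le> (2 * real k - 1) * (2 * real j + 1)"
      using nn mult_nonneg_nonneg[of "2 * real k" "2 * real j"] by (simp add: algebra_simps)
    have "real ((2 * k) choose (2 * Suc j)) * ((2 * real j + 2) * (2 * real j + 1))
        \<le> (real (k choose j) * (2 * real k - 1) ^ j)
          * (2 * (real k - real j) * ((2 * real k - 1) * (2 * real j + 1)))"
      unfolding two' using True nn
      by (intro mult_mono Suc.IH le mult_left_mono mult_nonneg_nonneg) auto
    also have "\<dots> = (real (k choose j) * (real k - real j))
        * ((2 * real k - 1) ^ Suc j * 2 * (2 * real j + 1))"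
      by (simp add: algebra_simps)
    also have "\<dots> = (real (k choose Suc j) * (2 * real k - 1) ^ Suc j)
        * ((2 * real j + 2) * (2 * real j + 1))"
      unfolding one'[symmetric] by (simp add: algebra_simps)
    finally show ?thesis
      by (rule mult_right_le_imp_le) (simp add: add_pos_pos)
  next
    case False
    show ?thesis
      using False by (simp add: binomial_eq_0)
  qed
qed simp

text \<open>The two-point hypercontractive inequality for the exponent \<open>2k\<close>, by comparing coefficients.\<close>
lemma two_point_real:
  fixes x y :: real
  shows "(x + y) ^ (2 * k) + (x - y) ^ (2 * k) \<le> 2 * (x\<^sup>2 + (2 * real k - 1) * y\<^sup>2) ^ k"
proof -
  have even: "(\<Sum>i\<le>2*k. g i) = (\<Sum>j\<le>k. g (2 * j))" if "\<And>i. odd i \<Longrightarrow> g i = (0::real)" for g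
  proof -
    have "(\<Sum>j\<le>k. g (2 * j)) = (\<Sum>i\<in>(\<lambda>j. 2 * j) ` {..k}. g i)"
      by (subst sum.reindex) (auto simp: inj_on_def)
    also have "\<dots> = (\<Sum>i\<le>2*k. g i)"
    proof (rule sum.mono_neutral_left)
      show "\<forall>i\<in>{..2*k} - (\<lambda>j. 2 * j) ` {..k}. g i = 0"
      proof
        fix i assume "i \<in> {..2*k} - (\<lambda>j. 2 * j) ` {..k}"
        then have "odd i"
          by (auto simp: image_iff elim!: evenE)
        then show "g i = 0"
          by (rule that)
      qed
    qed auto
    finally show ?thesis ..
  qed
  have "(x + y) ^ (2 * k) + (x - y) ^ (2 * k)
      = (\<Sum>i\<le>2*k. of_nat ((2 * k) choose i) * (y ^ i + (- y) ^ i) * x ^ (2 * k - i))"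
    using binomial_ring[of y x "2 * k"] binomial_ring[of "- y" x "2 * k"]
    by (simp add: algebra_simps sum.distrib)
  also have "\<dots> = (\<Sum>j\<le>k. of_nat ((2 * k) choose (2 * j)) * (y ^ (2 * j) + (- y) ^ (2 * j)) * x ^ (2 * k - 2 * j))"
    by (rule even) simp
  also have "\<dots> = (\<Sum>j\<le>k. real ((2 * k) choose (2 * j)) * (2 * (y\<^sup>2) ^ j * (x\<^sup>2) ^ (k - j)))"
    by (intro sum.cong) (simp_all add: diff_mult_distrib2[symmetric] flip: power_mult)
  also have "\<dots> \<le> (\<Sum>j\<le>k. (real (k choose j) * (2 * real k - 1) ^ j) * (2 * (y\<^sup>2) ^ j * (x\<^sup>2) ^ (k - j)))"
    by (intro sum_mono mult_right_mono binomial_even_le) auto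
  also have "\<dots> = 2 * ((2 * real k - 1) * y\<^sup>2 + x\<^sup>2) ^ k"
    unfolding binomial_ring sum_distrib_left
    by (intro sum.cong) (simp_all add: power_mult_distrib mult_ac)
  finally show ?thesis
    by (simp add: add.commute)
qed

text \<open>The alternating word is expanded letter by letter, and the prefix \<open>l\<close>
  collects the chosen letters. Taking \<open>H\<close> out of \<open>X - H\<close> costs a sign,
  which swaps \<open>e\<close> with \<open>- e\<close>; the scalars \<open>x + h\<close> and
  \<open>x - h\<close> obey the same recursion. A fully expanded word is bounded by Hoelder's
  inequality.\<close>

lemma two_point_trace:
  fixes X H :: "complex ^ 'd ^ 'd"
  assumes k: "k \<ge> 1" and e: "e = 1 \<or> e = (-1::real)"
    and len: "length l + n = 2 * k"
  shows "cmod (trace (mprod (l @ alt (X + H) n)) + e * trace (mprod (l @ alt (X - H) n)))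
    \<le> prod_list (map (schatten k) l)
      * ((schatten k X + schatten k H) ^ n + e * (schatten k X - schatten k H) ^ n)"
  using e len
proof (induction n arbitrary: l X H e)
  case 0
  then show ?case
    using trace_mprod_le[OF k, of l] by (auto simp: norm_mult mult_2[symmetric])
next
  case (Suc n)
  define Tp where "Tp = (\<lambda>A. trace (mprod ((l @ [A]) @ alt (adj X + adj H) n)))"
  define Tm where "Tm = (\<lambda>A. trace (mprod ((l @ [A]) @ alt (adj X - adj H) n)))"
  define x where "x = schatten k X"
  define h where "h = schatten k H"
  define L where "L = prod_list (map (schatten k) l)"
  have e': "- e = 1 \<or> - e = -1" and len': "length (l @ [A]) + n = 2 * k" for A
    using Suc.prems by auto
  have p: "trace (mprod (l @ alt (X + H) (Suc n))) = Tp X + Tp H"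
    by (simp add: Tp_def mprod_append adj_add matrix_mult_bilinear_simps
        trace_add_complex matrix_mul_assoc)
  have m: "trace (mprod (l @ alt (X - H) (Suc n))) = Tm X - Tm H"
    by (simp add: Tm_def mprod_append adj_diff matrix_mult_bilinear_simps
        trace_diff_complex matrix_mul_assoc)
  have "cmod (Tp X + Tp H + e * (Tm X - Tm H)) \<le> cmod (Tp X + e * Tm X) + cmod (Tp H + (- e) * Tm H)"
    by (rule order_trans[OF _ norm_triangle_ineq]) (simp add: algebra_simps)
  also have "cmod (Tp X + e * Tm X) \<le> L * x * ((x + h) ^ n + e * (x - h) ^ n)"
    using Suc.IH[OF Suc.prems(1) len'[of X], of "adj X" "adj H"]
    by (simp add: Tp_def Tm_def x_def h_def L_def)
  also have "cmod (Tp H + (- e) * Tm H) \<le> L * h * ((x + h) ^ n + (- e) * (x - h) ^ n)"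
    using Suc.IH[OF e' len'[of H], of "adj X" "adj H"]
    by (simp add: Tp_def Tm_def x_def h_def L_def)
  finally show ?case
    unfolding p m x_def[symmetric] h_def[symmetric] L_def[symmetric] by (simp add: algebra_simps)
qed

text \<open>Convexity of the \<open>k\<close>-th power bounds the power of the mean by the mean of
  the powers; then the power is removed by monotonicity.\<close>

lemma power_mean_root:
  assumes "k \<ge> 1" "a \<ge> 0" "b \<ge> (0::real)" "c \<ge> 0" "a ^ k + b ^ k \<le> 2 * c ^ k"
  shows "a + b \<le> 2 * c"
proof -
  have "convex_on {0..} (\<lambda>x::real. x ^ k)"
    by (rule convex_on_realI[where f' = "\<lambda>x. real k * x ^ (k - 1)"])
      (auto intro!: derivative_eq_intros mult_left_mono power_mono)
  from convex_onD[OF this, of "1/2" a b] have "((a + b) / 2) ^ k \<le> (a ^ k + b ^ k) / 2"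
    using assms by (simp add: add_divide_distrib)
  also have "\<dots> \<le> c ^ k"
    using assms by simp
  finally have "(a + b) / 2 \<le> c"
    using assms(1,4) power_mono_iff[of "(a + b) / 2" c k] assms(2,3) by simp
  then show ?thesis
    by simp
qed

text \<open>The trace bound and the scalar inequality give this for the \<open>k\<close>-th powers
  of the squares, and \<open>power_mean_root\<close> removes the power. With
  \<open>p = 2 * k\<close> the constant is \<open>p - 1\<close>.\<close>

lemma schatten_two_point:
  assumes k: "k \<ge> 1"
  shows "(schatten k (X + H))\<^sup>2 + (schatten k (X - H))\<^sup>2
    \<le> 2 * ((schatten k X)\<^sup>2 + (2 * real k - 1) * (schatten k H)\<^sup>2)"
proof (rule power_mean_root[OF k])
  have "schatten k (X + H) ^ (2 * k) + schatten k (X - H) ^ (2 * k)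
      = cmod (complex_of_real (schatten k (X + H) ^ (2 * k) + schatten k (X - H) ^ (2 * k)))"
    using k by (subst norm_of_real) simp
  also have "\<dots> = cmod (trace (mprod ([] @ alt (X + H) (2 * k)))
      + complex_of_real 1 * trace (mprod ([] @ alt (X - H) (2 * k))))"
    using k by (simp add: trace_alt_schatten)
  also have "\<dots> \<le> (schatten k X + schatten k H) ^ (2 * k) + (schatten k X - schatten k H) ^ (2 * k)"
    using two_point_trace[OF k, of 1 "[]" "2 * k" X H] by simp
  also have "\<dots> \<le> 2 * ((schatten k X)\<^sup>2 + (2 * real k - 1) * (schatten k H)\<^sup>2) ^ k"
    by (rule two_point_real)
  finally show "((schatten k (X + H))\<^sup>2) ^ k + ((schatten k (X - H))\<^sup>2) ^ k
      \<le> 2 * ((schatten k X)\<^sup>2 + (2 * real k - 1) * (schatten k H)\<^sup>2) ^ k"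
    by (simp flip: power_mult)
qed (use k in auto)

section \<open>Homogeneity and differentiability of Schatten norms\<close>

lemma schatten_scaleR:
  assumes "k \<ge> 1"
  shows "schatten k (c *\<^sub>R A) = \<bar>c\<bar> * schatten k A"
proof -
  have "mprod (alt (c *\<^sub>R A) n) = c ^ n *\<^sub>R mprod (alt A n)" for n
  proof (induction n arbitrary: A)
    case (Suc n)
    then show ?case
      by (simp add: adj_scaleR matrix_mult_bilinear_simps)
  qed simp
  then show ?thesis
    using assms by (simp add: schatten_def real_root_mult power_abs real_root_power_cancel)
qed

lemma has_derivative_mprod_alt: "\<exists>D. ((\<lambda>A. mprod (alt A n)) has_derivative D) (at X)"
proof (induction n arbitrary: X)
  case (Suc n)
  obtain D where D: "((\<lambda>A. mprod (alt A n)) has_derivative D) (at (adj X))"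
    using Suc by blast
  have "((\<lambda>A. mprod (alt (adj A) n)) has_derivative (\<lambda>H. D (adj H))) (at X)"
    using diff_chain_at[OF bounded_linear_imp_has_derivative[OF bounded_linear_adj] D]
    by (simp add: o_def)
  from bounded_bilinear.FDERIV[OF bounded_bilinear_matrix_mult has_derivative_ident this]
  show ?case
    by auto
qed (auto intro: exI[of _ "\<lambda>_. 0"])

lemma continuous_on_mprod_alt: "continuous_on S (\<lambda>A. mprod (alt A n))"
  using has_derivative_mprod_alt[of n] has_derivative_continuous
  by (intro continuous_at_imp_continuous_on) blast

lemma continuous_on_schatten: "k \<ge> 1 \<Longrightarrow> continuous_on S (schatten k)"
  unfolding schatten_def[abs_def]
  by (intro continuous_on_real_root continuous_on_norm continuous_on_mprod_alt)

text \<open>Away from 0 the alternating product does not vanish, so its Frobenius norm is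
  differentiable and the root is taken at a positive number.\<close>

lemma schatten_power2_has_derivative:
  assumes "k \<ge> 1" "X \<noteq> 0"
  shows "\<exists>D. ((\<lambda>A. (schatten k A)\<^sup>2) has_derivative D) (at X)"
proof -
  have nz: "mprod (alt X k) \<noteq> 0"
    using assms mprod_alt_eq_0 by blast
  obtain D where "((\<lambda>A. mprod (alt A k)) has_derivative D) (at X)"
    using has_derivative_mprod_alt by blast
  from diff_chain_at[OF this has_derivative_norm[OF nz]]
  obtain D' where D': "((\<lambda>A. norm (mprod (alt A k))) has_derivative D') (at X)"
    by (auto simp: o_def)
  have "(root k has_derivative (*) (inverse (real k * root k (norm (mprod (alt X k))) ^ (k - Suc 0))))
      (at (norm (mprod (alt X k))))"
    using DERIV_real_root[of k "norm (mprod (alt X k))"] assms nz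
    unfolding has_field_derivative_def by simp
  from diff_chain_at[OF D' this] have "\<exists>D. (schatten k has_derivative D) (at X)"
    unfolding schatten_def[abs_def] by (auto simp: o_def)
  then show ?thesis
    by (blast intro: has_derivative_power)
qed

text \<open>For \<open>X \<noteq> 0\<close> the map \<open>D\<close> is the derivative of the
  squared norm at \<open>X\<close>, and the two-point inequality at dyadic scales in direction
  \<open>H\<close> gives the bound in the limit. A linear term is wanted because it has expectation
  zero when \<open>H\<close> is random with mean zero.\<close>

lemma schatten_smooth:
  assumes k: "k \<ge> 1"
  shows "\<exists>D. bounded_linear D \<and>
    (\<forall>H. (schatten k (X + H))\<^sup>2 \<le> (schatten k X)\<^sup>2 + D H + (2 * real k - 1) * (schatten k H)\<^sup>2)"
proof (cases "X = 0")
  case True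
  have "a \<le> (2 * real k - 1) * a" if "a \<ge> 0" for a
    using k that mult_right_mono[of 1 "2 * real k - 1" a] by simp
  then show ?thesis
    using True k by (intro exI[of _ "\<lambda>_. 0"]) (auto simp: schatten_eq_0_iff[THEN iffD2])
next
  case False
  define f where "f = (\<lambda>A :: complex^'a^'a. (schatten k A)\<^sup>2)"
  define C where "C = 2 * real k - 1"
  obtain D where D: "(f has_derivative D) (at X)"
    using schatten_power2_has_derivative[OF k False] unfolding f_def by blast
  have f_scale: "f (c *\<^sub>R H) = c\<^sup>2 * f H" for c H
    using k by (simp add: f_def schatten_scaleR power_mult_distrib)
  have "f (X + H) \<le> f X + D H + C * f H" for H
  proof -
    \<comment> \<open>Subtracting the quadratic term absorbs the error of the two-point inequality
      centred at \<open>X + s *\<^sub>R H\<close>, which leaves the concavity-type bound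
      \<open>mid\<close>.\<close>
    define \<phi> where "\<phi> = (\<lambda>t. f (X + t *\<^sub>R H) - C * t\<^sup>2 * f H)"
    have mid: "\<phi> (2 * s) + \<phi> 0 \<le> 2 * \<phi> s" for s
    proof -
      have "f ((X + s *\<^sub>R H) + s *\<^sub>R H) + f ((X + s *\<^sub>R H) - s *\<^sub>R H)
          \<le> 2 * (f (X + s *\<^sub>R H) + C * f (s *\<^sub>R H))"
        unfolding f_def C_def by (rule schatten_two_point[OF k])
      moreover have "(X + s *\<^sub>R H) + s *\<^sub>R H = X + (2 * s) *\<^sub>R H"
        by (simp add: scaleR_2 flip: scaleR_scaleR)
      ultimately show ?thesis
        by (simp add: \<phi>_def f_scale power_mult_distrib mult_ac)
    qed
    \<comment> \<open>By \<open>mid\<close> the difference quotient of \<open>\<phi>\<close> at 0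
      does not decrease when the step is halved; its limit is \<open>D H\<close>.\<close>
    have dyadic: "\<phi> 1 - \<phi> 0 \<le> 2 ^ n * (\<phi> ((1/2) ^ n) - \<phi> 0)" for n
    proof (induction n)
      case (Suc n)
      have "2 ^ n * (\<phi> ((1/2) ^ n) - \<phi> 0) \<le> 2 ^ n * (2 * (\<phi> ((1/2) ^ Suc n) - \<phi> 0))"
        using mid[of "(1/2) ^ Suc n"] by (intro mult_left_mono) auto
      then show ?case
        using Suc.IH by (simp add: algebra_simps)
    qed simp
    have "((\<lambda>t. X + t *\<^sub>R H) has_derivative (\<lambda>t. t *\<^sub>R H)) (at 0)"
      by (auto intro!: derivative_eq_intros)
    from diff_chain_at[OF this, of f D] D
    have "((\<lambda>t. f (X + t *\<^sub>R H)) has_derivative (\<lambda>t. D (t *\<^sub>R H))) (at 0)"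
      by (simp add: o_def)
    moreover have "(\<lambda>t. D (t *\<^sub>R H)) = (*) (D H)"
      using linear_scale[OF has_derivative_linear[OF D]] by auto
    ultimately have "((\<lambda>t. f (X + t *\<^sub>R H)) has_real_derivative D H) (at 0)"
      unfolding has_field_derivative_def by simp
    then have "(\<phi> has_real_derivative D H) (at 0)"
      unfolding \<phi>_def by (auto intro!: derivative_eq_intros)
    then have lim: "((\<lambda>h. (\<phi> h - \<phi> 0) / h) \<longlongrightarrow> D H) (at 0)"
      by (simp add: DERIV_def)
    have "filterlim (\<lambda>n. (1/2::real) ^ n) (at 0) sequentially"
      unfolding filterlim_at by (auto intro!: LIMSEQ_realpow_zero)
    from filterlim_compose[OF lim this]
    have "(\<lambda>n. 2 ^ n * (\<phi> ((1/2) ^ n) - \<phi> 0)) \<longlonglongrightarrow> D H"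
      by (simp add: field_simps power_divide)
    then have "\<phi> 1 - \<phi> 0 \<le> D H"
      by (rule LIMSEQ_le_const) (use dyadic in auto)
    then show ?thesis
      by (simp add: \<phi>_def)
  qed
  then show ?thesis
    using has_derivative_bounded_linear[OF D] by (auto simp: f_def C_def)
qed

subsection \<open>Comparison with the spectral norm\<close>

lemma spectral_norm_nonneg: "spectral_norm A \<ge> 0"
  unfolding spectral_norm_def by (rule onorm_pos_le) simp

lemma norm_matrix_vector_le: "norm (A *v x) \<le> spectral_norm A * norm x"
  unfolding spectral_norm_def by (rule onorm) simp

text \<open>The columns of \<open>A ** B\<close> are the images under \<open>A\<close> of the
  columns of \<open>B\<close>, and the squared Frobenius norm is additive over columns.\<close>

lemma norm_matrix_mult_le:
  fixes A B :: "complex ^ 'd ^ 'd"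
  shows "norm (A ** B) \<le> spectral_norm A * norm B"
proof -
  have col: "(norm C)\<^sup>2 = (\<Sum>j\<in>UNIV. (norm (\<chi> i. C $ i $ j))\<^sup>2)" for C :: "complex^'d^'d"
    unfolding norm_matrix_power2
    by (subst sum.swap) (simp add: norm_vec_def L2_set_def sum_nonneg)
  have "(norm (A ** B))\<^sup>2 = (\<Sum>j\<in>UNIV. (norm (A *v (\<chi> i. B $ i $ j)))\<^sup>2)"
    unfolding col by (simp add: matrix_matrix_mult_def matrix_vector_mult_def)
  also have "\<dots> \<le> (\<Sum>j\<in>UNIV. (spectral_norm A * norm (\<chi> i. B $ i $ j))\<^sup>2)"
    by (intro sum_mono power_mono norm_matrix_vector_le) auto
  also have "\<dots> = (spectral_norm A * norm B)\<^sup>2"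
    unfolding power_mult_distrib col sum_distrib_left ..
  finally show ?thesis
    by (rule power2_le_imp_le) (simp add: spectral_norm_nonneg)
qed

text \<open>One factor \<open>A ** X\<close> stands at the front of its alternating word.  Pulling \<open>A\<close>
  out leaves a word with two letters \<open>X\<close> and \<open>2k - 2\<close> letters \<open>A ** X\<close>.\<close>
lemma schatten_mult_le:
  fixes A X :: "complex ^ 'd ^ 'd"
  assumes k: "k \<ge> 1"
  shows "schatten k (A ** X) \<le> spectral_norm A * schatten k X"
proof (cases "A ** X = 0")
  case True
  then show ?thesis
    using k by (simp add: schatten_eq_0_iff[THEN iffD2] spectral_norm_nonneg)
next
  case False
  define B where "B = A ** X"
  define b where "b = schatten k B"
  define l where "l = alt (adj B) (k - 1)"
  have b: "b > 0"
    using False k by (simp add: b_def B_def schatten_pos)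
  have "map (schatten k) (alt C n) = replicate n (schatten k C)" for C :: "complex^'d^'d" and n
    by (induction n arbitrary: C) auto
  then have prod_l: "prod_list (map (schatten k) l) = b ^ (k - 1)"
    by (simp add: l_def b_def)
  have "b ^ (2 * k) = (norm (mprod (alt B k)))\<^sup>2"
    using k by (simp add: b_def schatten_power power_even_eq)
  also have "alt B k = B # l"
    using k by (cases k) (auto simp: l_def)
  also have "(norm (mprod (B # l)))\<^sup>2 \<le> (spectral_norm A * norm (mprod (X # l)))\<^sup>2"
    unfolding B_def by (intro power_mono) (simp_all add: norm_matrix_mult_le flip: matrix_mul_assoc)
  also have "(norm (mprod (X # l)))\<^sup>2 \<le> prod_list (map (schatten k) ((X # l) @ rev (map adj (X # l))))"
    unfolding norm_mprod_power2 by (rule trace_mprod_le[OF k]) (use k in \<open>simp add: l_def\<close>)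
  then have "(spectral_norm A * norm (mprod (X # l)))\<^sup>2
      \<le> (spectral_norm A)\<^sup>2 * ((schatten k X)\<^sup>2 * b ^ (2 * (k - 1)))"
    unfolding power_mult_distrib
    by (intro mult_left_mono)
      (simp_all add: rev_map[symmetric] comp_def prod_l power2_eq_square mult_2 power_add mult_ac)
  also have "b ^ (2 * k) = b\<^sup>2 * b ^ (2 * (k - 1))"
    using k by (cases k) (simp_all add: power2_eq_square)
  finally have "b\<^sup>2 * b ^ (2 * (k - 1)) \<le> (spectral_norm A * schatten k X)\<^sup>2 * b ^ (2 * (k - 1))"
    by (simp add: power_mult_distrib mult_ac)
  \<comment> \<open>Cancelling the power of \<open>b\<close> needs \<open>b > 0\<close>; this is why
    a vanishing product is a separate case.\<close>
  then have "b\<^sup>2 \<le> (spectral_norm A * schatten k X)\<^sup>2"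
    using b by simp
  then have "b \<le> spectral_norm A * schatten k X"
    by (rule power2_le_imp_le) (use k in \<open>simp add: spectral_norm_nonneg\<close>)
  then show ?thesis
    by (simp add: b_def B_def)
qed

lemma spectral_norm_le_norm: "spectral_norm A \<le> norm A"
  unfolding spectral_norm_def
proof (rule onorm_bound)
  fix x
  have "norm ((A *v x) $ i) \<le> norm (A $ i) * norm x" for i
  proof -
    have "norm ((A *v x) $ i) \<le> (\<Sum>j\<in>UNIV. \<bar>cmod (A $ i $ j)\<bar> * \<bar>cmod (x $ j)\<bar>)"
      by (auto simp: matrix_vector_mult_def norm_mult intro!: sum_norm_le)
    also have "\<dots> \<le> norm (A $ i) * norm x"
      unfolding norm_vec_def by (rule L2_set_mult_ineq)
    finally show ?thesis .
  qed
  then have "norm (A *v x) \<le> L2_set (\<lambda>i. norm (A $ i) * norm x) UNIV"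
    unfolding norm_vec_def[of "A *v x"] by (intro L2_set_mono) auto
  also have "\<dots> = norm A * norm x"
    by (simp add: norm_vec_def[of A] L2_set_left_distrib)
  finally show "norm (A *v x) \<le> norm A * norm x" .
qed simp

text \<open>Splitting off one letter at a time, with its spectral norm bounded by the Frobenius
  norm, bounds the alternating word by \<open>norm A ^ k\<close>.\<close>

lemma schatten_le_norm:
  assumes k: "k \<ge> 1"
  shows "schatten k A \<le> norm A"
proof -
  have alt_le: "norm (mprod (alt A (Suc n))) \<le> norm A ^ Suc n" for n and A :: "complex^'a^'a"
  proof (induction n arbitrary: A)
    case (Suc n)
    have "norm (mprod (alt A (Suc (Suc n)))) \<le> spectral_norm A * norm (mprod (alt (adj A) (Suc n)))"
      by (simp only: alt.simps(2)[of A] mprod_Cons norm_matrix_mult_le)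
    also have "\<dots> \<le> norm A * norm (adj A) ^ Suc n"
      by (intro mult_mono spectral_norm_le_norm Suc.IH) auto
    finally show ?case
      by simp
  qed simp
  have "schatten k A ^ k \<le> norm A ^ k"
    using alt_le[of A "k - 1"] k by (simp add: schatten_power)
  then show ?thesis
    using k by (subst (asm) power_mono_iff) auto
qed

text \<open>Hoelder's inequality for the word \<open>A, R, A, R, \<dots>\<close> with the rank one matrix \<open>R = x y\<^sup>*\<close>,
  where \<open>y = A x\<close>; the trace of this word is \<open>|y| ^ (2k)\<close>.\<close>
lemma spectral_norm_le_schatten:
  fixes A :: "complex ^ 'd ^ 'd"
  assumes k: "k \<ge> 1"
  shows "spectral_norm A \<le> schatten k A"
  unfolding spectral_norm_def
proof (rule onorm_bound)
  fix x :: "complex ^ 'd"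
  define y where "y = A *v x"
  show "norm (A *v x) \<le> schatten k A * norm x"
  proof (cases "y = 0")
    case True
    then show ?thesis
      using k by (simp add: y_def)
  next
    case False
    define R :: "complex ^ 'd ^ 'd" where "R = (\<chi> i j. x $ i * cnj (y $ j))"
    define P :: "complex ^ 'd ^ 'd" where "P = (\<chi> i j. y $ i * cnj (y $ j))"
    define w where "w = (\<lambda>n. concat (replicate n [A, R]))"
    have norm_y: "(\<Sum>i\<in>UNIV. cnj (y $ i) * y $ i) = of_real ((norm y)\<^sup>2)"
      by (simp add: norm_vec_def L2_set_def sum_nonneg complex_norm_square mult.commute
          del: of_real_power)
    have AR: "A ** R = P"
      by (simp add: vec_eq_iff R_def P_def y_def matrix_matrix_mult_def matrix_vector_mult_def
          sum_distrib_right mult.assoc)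
    have PP: "P ** P = (norm y)\<^sup>2 *\<^sub>R P"
    proof -
      have "(P ** P) $ i $ j = y $ i * (\<Sum>l\<in>UNIV. cnj (y $ l) * y $ l) * cnj (y $ j)" for i j
        by (simp add: P_def matrix_matrix_mult_def sum_distrib_left sum_distrib_right mult_ac)
      then show ?thesis
        unfolding norm_y by (simp add: vec_eq_iff P_def scaleR_conv_of_real[where 'a = complex])
    qed
    \<comment> \<open>Each pair \<open>A, R\<close> multiplies to the rank one matrix
      \<open>P\<close>, whose square is a multiple of \<open>P\<close>, so the whole word collapses
      to a multiple of \<open>P\<close>.\<close>
    have "P ** mprod (w n) = ((norm y)\<^sup>2) ^ n *\<^sub>R P" for n
    proof (induction n)
      case (Suc n)
      have "P ** mprod (w (Suc n)) = P ** (P ** mprod (w n))"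
        by (simp add: w_def matrix_mul_assoc[of A] AR)
      then show ?case
        by (simp add: Suc PP matrix_mult_bilinear_simps)
    qed (simp add: w_def)
    from this[of "k - 1"] have "mprod (w k) = ((norm y)\<^sup>2) ^ (k - 1) *\<^sub>R P"
      using k by (cases k) (simp_all add: w_def matrix_mul_assoc[of A] AR)
    moreover have "trace P = of_real ((norm y)\<^sup>2)"
      unfolding norm_y[symmetric] by (simp add: trace_def P_def mult.commute)
    ultimately have "trace (mprod (w k)) = of_real (((norm y)\<^sup>2) ^ (k - 1) * (norm y)\<^sup>2)"
      by (simp only: trace_scaleR_complex of_real_mult)
    then have "((norm y)\<^sup>2) ^ (k - 1) * (norm y)\<^sup>2 = cmod (trace (mprod (w k)))"
      by (simp only: norm_of_real) simp
    also have "((norm y)\<^sup>2) ^ (k - 1) * (norm y)\<^sup>2 = ((norm y)\<^sup>2) ^ k"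
      using k by (cases k) simp_all
    also have "cmod (trace (mprod (w k))) \<le> prod_list (map (schatten k) (w k))"
    proof (rule trace_mprod_le[OF k])
      show "length (w k) = 2 * k"
        unfolding w_def by (induction k) simp_all
    qed
    also have "\<dots> = (schatten k A * schatten k R) ^ k"
    proof -
      have "prod_list (map (schatten k) (w n)) = (schatten k A * schatten k R) ^ n" for n
        unfolding w_def by (induction n) simp_all
      then show ?thesis .
    qed
    finally have "(norm y)\<^sup>2 \<le> schatten k A * schatten k R"
      using k by (subst (asm) power_mono_iff) auto
    moreover have "schatten k R \<le> norm x * norm y"
    proof -
      have "(norm R)\<^sup>2 = (norm x * norm y)\<^sup>2"
        unfolding norm_matrix_power2
        by (simp add: R_def norm_mult power_mult_distrib norm_vec_def L2_set_def sum_nonneg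
            sum_product)
      then show ?thesis
        using schatten_le_norm[OF k, of R] by simp
    qed
    then have "schatten k A * schatten k R \<le> schatten k A * (norm x * norm y)"
      using k by (intro mult_left_mono) auto
    ultimately have "norm y * norm y \<le> (schatten k A * norm x) * norm y"
      by (simp add: power2_eq_square mult.assoc)
    then show ?thesis
      using False by (simp add: y_def)
  qed
qed (use k in simp)

text \<open>The identity is the empty product, where the moment recursion starts; its norm is the
  source of the dimension in the final bounds.\<close>

lemma schatten_one: "k \<ge> 1 \<Longrightarrow> (schatten k (mat 1 :: complex ^ 'd ^ 'd))\<^sup>2 = root k (real CARD('d))"
proof -
  assume k: "k \<ge> 1"
  have "mprod (alt (mat 1 :: complex ^ 'd ^ 'd) n) = mat 1" for n
    by (induction n) auto
  moreover have "(norm (mat 1 :: complex ^ 'd ^ 'd))\<^sup>2 = real CARD('d)"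
    by (simp add: norm_matrix_power2 mat_def if_distrib[of cmod] if_distrib[of "\<lambda>x. x ^ 2"] cong: if_cong)
  ultimately show ?thesis
    using k by (simp add: schatten_def flip: real_root_power)
qed

subsection \<open>Products of independent random matrices\<close>

lemma measurable_matrix_mult [measurable (raw)]:
  fixes f g :: "'w \<Rightarrow> complex ^ 'd ^ 'd"
  assumes "f \<in> borel_measurable M" "g \<in> borel_measurable M"
  shows "(\<lambda>x. f x ** g x) \<in> borel_measurable M"
  using assms
  by (rule borel_measurable_continuous_Pair)
    (intro bounded_bilinear.continuous_on[OF bounded_bilinear_matrix_mult] continuous_intros)

lemma measurable_schatten:
  assumes "k \<ge> 1"
  shows "schatten k \<in> borel_measurable borel"
  by (intro borel_measurable_continuous_onI continuous_on_schatten assms)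

text \<open>The index set stays \<open>{1..k}\<close> while \<open>j\<close> varies, so the
  induction runs on one fixed product space.\<close>

lemma measurable_left_prod:
  "j \<le> k \<Longrightarrow> (\<lambda>f. left_prod f j) \<in> borel_measurable (Pi\<^sub>M {1..k} (\<lambda>_. borel :: (complex ^ 'd ^ 'd) measure))"
proof (induction j)
  case (Suc j)
  have "(\<lambda>f. f (Suc j)) \<in> borel_measurable (Pi\<^sub>M {1..k} (\<lambda>_. borel :: (complex ^ 'd ^ 'd) measure))"
    by (rule measurable_component_singleton) (use Suc.prems in simp)
  with Suc show ?case
    by (simp add: measurable_matrix_mult)
qed simp

lemma left_prod_cong: "(\<And>i. i \<in> {1..k} \<Longrightarrow> f i = g i) \<Longrightarrow> left_prod f k = left_prod g k"
  by (induction k) auto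

section \<open>Independence and one step of the moment recursion\<close>

context prob_space
begin

text \<open>The two variables are functions of the disjoint blocks \<open>{Suc k}\<close> and
  \<open>{1..k}\<close> of an independent family.\<close>

lemma indep_var_left_prod:
  fixes Y :: "nat \<Rightarrow> 'a \<Rightarrow> complex ^ 'd ^ 'd"
  assumes indep: "indep_vars (\<lambda>_. borel) Y {1..n}" and k: "Suc k \<le> n"
  shows "indep_var borel (Y (Suc k)) borel (\<lambda>\<omega>. left_prod (\<lambda>i. Y i \<omega>) k)"
proof -
  have "indep_var borel ((\<lambda>f. f (Suc k)) \<circ> (\<lambda>\<omega>. restrict (\<lambda>i. Y i \<omega>) {Suc k}))
      borel ((\<lambda>f. left_prod f k) \<circ> (\<lambda>\<omega>. restrict (\<lambda>i. Y i \<omega>) {1..k}))"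
  proof (rule indep_var_compose[OF indep_var_restrict[OF indep]])
    show "(\<lambda>f. f (Suc k)) \<in> borel_measurable (Pi\<^sub>M {Suc k} (\<lambda>_. borel))"
      by (rule measurable_component_singleton) simp
  qed (use k measurable_left_prod in auto)
  also have "(\<lambda>f. f (Suc k)) \<circ> (\<lambda>\<omega>. restrict (\<lambda>i. Y i \<omega>) {Suc k}) = Y (Suc k)"
    by auto
  also have "(\<lambda>f. left_prod f k) \<circ> (\<lambda>\<omega>. restrict (\<lambda>i. Y i \<omega>) {1..k})
      = (\<lambda>\<omega>. left_prod (\<lambda>i. Y i \<omega>) k)"
    by (auto simp: fun_eq_iff intro!: left_prod_cong)
  finally show ?thesis .
qed

text \<open>Integrability follows from that of the product of the two independent norms. The
  expectation is computed entrywise, where each entry is a sum of products of independent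
  scalars.\<close>

lemma
  fixes Y Z :: "'a \<Rightarrow> complex ^ 'd ^ 'd"
  assumes indep: "indep_var borel Y borel Z" and Y: "integrable M Y" and Z: "integrable M Z"
  shows integrable_matrix_mult: "integrable M (\<lambda>\<omega>. Y \<omega> ** Z \<omega>)"
    and integral_matrix_mult: "(\<integral>\<omega>. Y \<omega> ** Z \<omega> \<partial>M) = integral\<^sup>L M Y ** integral\<^sup>L M Z"
proof -
  have [measurable]: "Y \<in> borel_measurable M" "Z \<in> borel_measurable M"
    using Y Z by auto
  have "indep_var borel (norm \<circ> Y) borel (norm \<circ> Z)"
    by (rule indep_var_compose[OF indep]) auto
  then have "integrable M (\<lambda>\<omega>. (norm \<circ> Y) \<omega> * (norm \<circ> Z) \<omega>)"
    by (rule indep_var_integrable) (use Y Z in \<open>auto simp: comp_def\<close>)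
  then show YZ: "integrable M (\<lambda>\<omega>. Y \<omega> ** Z \<omega>)"
  proof (rule Bochner_Integration.integrable_bound)
    show "AE \<omega> in M. norm (Y \<omega> ** Z \<omega>) \<le> norm ((norm \<circ> Y) \<omega> * (norm \<circ> Z) \<omega>)"
    proof (rule AE_I2)
      fix \<omega>
      have "norm (Y \<omega> ** Z \<omega>) \<le> norm (Y \<omega>) * norm (Z \<omega>)"
        by (rule order_trans[OF norm_matrix_mult_le])
          (intro mult_right_mono spectral_norm_le_norm norm_ge_zero)
      then show "norm (Y \<omega> ** Z \<omega>) \<le> norm ((norm \<circ> Y) \<omega> * (norm \<circ> Z) \<omega>)"
        by simp
    qed
  qed simp
  have entry: "bounded_linear (\<lambda>A :: complex ^ 'd ^ 'd. A $ i $ j)" for i j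
    by (intro bounded_linear_compose[OF bounded_linear_vec_nth bounded_linear_vec_nth])
  have int_entry: "(\<integral>\<omega>. X \<omega> $ i $ j \<partial>M) = integral\<^sup>L M X $ i $ j"
    and integrable_entry: "integrable M (\<lambda>\<omega>. X \<omega> $ i $ j)"
    if "integrable M X" for X :: "'a \<Rightarrow> complex ^ 'd ^ 'd" and i j
    using integral_bounded_linear[OF entry that] integrable_bounded_linear[OF entry that] by auto
  have prod: "indep_var borel (\<lambda>\<omega>. Y \<omega> $ i $ l) borel (\<lambda>\<omega>. Z \<omega> $ l $ j)" for i j l
  proof -
    have "(\<lambda>A :: complex ^ 'd ^ 'd. A $ i $ j) \<in> borel_measurable borel" for i j
      by (intro borel_measurable_continuous_onI bounded_linear.continuous_on[OF entry]) simp
    from indep_var_compose[OF indep this this] show ?thesis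
      by (simp add: comp_def)
  qed
  have "(\<integral>\<omega>. Y \<omega> ** Z \<omega> \<partial>M) $ i $ j = (integral\<^sup>L M Y ** integral\<^sup>L M Z) $ i $ j" for i j
  proof -
    have "(\<integral>\<omega>. Y \<omega> ** Z \<omega> \<partial>M) $ i $ j = (\<integral>\<omega>. (\<Sum>l\<in>UNIV. Y \<omega> $ i $ l * Z \<omega> $ l $ j) \<partial>M)"
      unfolding int_entry[OF YZ, symmetric] by (simp add: matrix_matrix_mult_def)
    also have "\<dots> = (\<Sum>l\<in>UNIV. \<integral>\<omega>. Y \<omega> $ i $ l * Z \<omega> $ l $ j \<partial>M)"
      by (intro Bochner_Integration.integral_sum indep_var_integrable prod integrable_entry Y Z)
    also have "\<dots> = (\<Sum>l\<in>UNIV. integral\<^sup>L M Y $ i $ l * integral\<^sup>L M Z $ l $ j)"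
      by (simp add: indep_var_lebesgue_integral[OF prod integrable_entry[OF Y] integrable_entry[OF Z]]
          int_entry Y Z)
    finally show ?thesis
      by (simp add: matrix_matrix_mult_def)
  qed
  then show "(\<integral>\<omega>. Y \<omega> ** Z \<omega> \<partial>M) = integral\<^sup>L M Y ** integral\<^sup>L M Z"
    by (simp add: vec_eq_iff)
qed

text \<open>For a fixed value \<open>z\<close> of \<open>Z\<close>, smoothness is applied at
  \<open>E Y ** (z - c)\<close> with increment \<open>(Y - E Y) ** z\<close>: the linear term has
  mean zero and the quadratic one costs \<open>(2 * k - 1) * s\<close>. Later \<open>c\<close> is
  \<open>0\<close> or the mean of \<open>Z\<close>.\<close>

lemma
  fixes Y Z :: "'a \<Rightarrow> complex ^ 'd ^ 'd" and c :: "complex ^ 'd ^ 'd"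
  assumes k: "k \<ge> 1" and indep: "indep_var borel Y borel Z" and Y: "integrable M Y"
    and V: "integrable M (\<lambda>\<omega>. (spectral_norm (Y \<omega> - integral\<^sup>L M Y))\<^sup>2)"
    and s: "(\<integral>\<omega>. (spectral_norm (Y \<omega> - integral\<^sup>L M Y))\<^sup>2 \<partial>M) \<le> s"
    and m: "spectral_norm (integral\<^sup>L M Y) \<le> m"
    and Z: "integrable M (\<lambda>\<omega>. (schatten k (Z \<omega>))\<^sup>2)"
    and Zc: "integrable M (\<lambda>\<omega>. (schatten k (Z \<omega> - c))\<^sup>2)"
  shows integrable_schatten_step:
      "integrable M (\<lambda>\<omega>. (schatten k (Y \<omega> ** Z \<omega> - integral\<^sup>L M Y ** c))\<^sup>2)" (is ?int)
    and integral_schatten_step: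
      "(\<integral>\<omega>. (schatten k (Y \<omega> ** Z \<omega> - integral\<^sup>L M Y ** c))\<^sup>2 \<partial>M)
        \<le> m\<^sup>2 * (\<integral>\<omega>. (schatten k (Z \<omega> - c))\<^sup>2 \<partial>M)
          + (2 * real k - 1) * s * (\<integral>\<omega>. (schatten k (Z \<omega>))\<^sup>2 \<partial>M)" (is ?le)
proof -
  define f where "f = (\<lambda>A :: complex ^ 'd ^ 'd. (schatten k A)\<^sup>2)"
  define B where "B = integral\<^sup>L M Y"
  define C where "C = 2 * real k - 1"
  define W where "W = (\<lambda>\<omega>. (spectral_norm (Y \<omega> - B))\<^sup>2)"
  have C: "C \<ge> 0"
    using k by (simp add: C_def)
  have f0: "f A \<ge> 0" for A
    by (simp add: f_def)
  have s0: "s \<ge> 0"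
    by (rule order_trans[OF _ s]) (rule Bochner_Integration.integral_nonneg, simp)
  have [measurable]: "Y \<in> borel_measurable M" "Z \<in> borel_measurable M"
    using indep_var_rv1[OF indep] indep_var_rv2[OF indep] by auto
  note measurable_schatten[OF k, measurable]
  have [measurable]: "f \<in> borel_measurable borel"
    unfolding f_def by measurable
  have f_mult: "f (A ** X) \<le> (spectral_norm A)\<^sup>2 * f X" for A X
    unfolding f_def power_mult_distrib[symmetric]
    by (intro power_mono schatten_mult_le) (use k in auto)
  have inner: "(\<integral>\<^sup>+\<omega>. ennreal (f (Y \<omega> ** z - B ** c)) \<partial>M) \<le> ennreal (m\<^sup>2 * f (z - c) + C * s * f z)" for z
  proof -
    define X where "X = B ** (z - c)"
    obtain D where D: "bounded_linear D"
      and smooth: "\<And>H. f (X + H) \<le> f X + D H + C * f H"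
      using schatten_smooth[OF k, of X] unfolding f_def C_def by blast
    define L where "L = (\<lambda>A. D (A ** z))"
    have L: "bounded_linear L"
      unfolding L_def
      by (rule bounded_linear_compose[OF D bounded_bilinear.bounded_linear_left[OF bounded_bilinear_matrix_mult]])
    define h where "h = (\<lambda>\<omega>. m\<^sup>2 * f (z - c) + L (Y \<omega> - B) + C * (W \<omega> * f z))"
    have YB: "integrable M (\<lambda>\<omega>. Y \<omega> - B)"
      using Y by simp
    have W: "integrable M W"
      using V unfolding W_def B_def .
    have "integrable M h"
      unfolding h_def
      by (intro Bochner_Integration.integrable_add integrable_mult_right integrable_mult_left W
          integrable_bounded_linear[OF L YB]) simp
    \<comment> \<open>Bounded linear maps commute with the integral, so the linear term of the
      smoothness bound disappears.\<close>
    have "(\<integral>\<omega>. Y \<omega> - B \<partial>M) = 0"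
      using Y by (simp add: B_def prob_space)
    then have "(\<integral>\<omega>. L (Y \<omega> - B) \<partial>M) = 0"
      using integral_bounded_linear[OF L YB] L by (simp add: linear_simps)
    then have "integral\<^sup>L M h = m\<^sup>2 * f (z - c) + C * (integral\<^sup>L M W * f z)"
      unfolding h_def using W integrable_bounded_linear[OF L YB] by (simp add: prob_space)
    also have "\<dots> \<le> m\<^sup>2 * f (z - c) + C * (s * f z)"
      using s unfolding B_def[symmetric] W_def[symmetric]
      by (intro add_left_mono mult_left_mono mult_right_mono f0 C)
    finally have int_h: "integral\<^sup>L M h \<le> m\<^sup>2 * f (z - c) + C * s * f z"
      by (simp add: mult.assoc)
    have le: "f (Y \<omega> ** z - B ** c) \<le> h \<omega>" for \<omega>
    proof -
      have "Y \<omega> ** z - B ** c = X + (Y \<omega> - B) ** z"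
        by (simp add: X_def matrix_mult_bilinear_simps)
      then have "f (Y \<omega> ** z - B ** c) \<le> f X + L (Y \<omega> - B) + C * f ((Y \<omega> - B) ** z)"
        using smooth by (simp add: L_def)
      also have "f X \<le> m\<^sup>2 * f (z - c)"
        unfolding X_def using m unfolding B_def[symmetric]
        by (intro order_trans[OF f_mult] mult_right_mono power_mono f0 spectral_norm_nonneg)
      also have "C * f ((Y \<omega> - B) ** z) \<le> C * (W \<omega> * f z)"
        unfolding W_def by (intro mult_left_mono f_mult C)
      finally show ?thesis
        by (simp add: h_def)
    qed
    have "(\<integral>\<^sup>+\<omega>. ennreal (f (Y \<omega> ** z - B ** c)) \<partial>M) \<le> (\<integral>\<^sup>+\<omega>. ennreal (h \<omega>) \<partial>M)"
      by (intro nn_integral_mono ennreal_leI le)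
    also have "\<dots> = ennreal (integral\<^sup>L M h)"
      by (rule nn_integral_eq_integral[OF \<open>integrable M h\<close>]) (use le f0 order_trans in \<open>blast intro: AE_I2\<close>)
    also have "\<dots> \<le> ennreal (m\<^sup>2 * f (z - c) + C * s * f z)"
      by (intro ennreal_leI int_h)
    finally show ?thesis .
  qed
  interpret PY: prob_space "distr M borel Y"
    by (rule prob_space_distr) simp
  interpret PZ: prob_space "distr M borel Z"
    by (rule prob_space_distr) simp
  interpret PYZ: pair_sigma_finite "distr M borel Y" "distr M borel Z" ..
  \<comment> \<open>Independence turns the joint law into a product law, so Tonelli's theorem
    reduces the expectation to the bound for fixed \<open>z\<close>.\<close>
  have eq: "distr M borel Y \<Otimes>\<^sub>M distr M borel Z = distr M (borel \<Otimes>\<^sub>M borel) (\<lambda>\<omega>. (Y \<omega>, Z \<omega>))"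
    using indep unfolding indep_var_distribution_eq by simp
  define r where "r = m\<^sup>2 * (\<integral>\<omega>. f (Z \<omega> - c) \<partial>M) + C * s * (\<integral>\<omega>. f (Z \<omega>) \<partial>M)"
  have "(\<integral>\<^sup>+\<omega>. ennreal (f (Y \<omega> ** Z \<omega> - B ** c)) \<partial>M)
      = (\<integral>\<^sup>+p. ennreal (f (fst p ** snd p - B ** c)) \<partial>(distr M (borel \<Otimes>\<^sub>M borel) (\<lambda>\<omega>. (Y \<omega>, Z \<omega>))))"
    by (subst nn_integral_distr) simp_all
  also have "\<dots> = (\<integral>\<^sup>+z. \<integral>\<^sup>+y. ennreal (f (y ** z - B ** c)) \<partial>distr M borel Y \<partial>distr M borel Z)"
    unfolding eq[symmetric] by (subst PYZ.nn_integral_snd[symmetric]) simp_all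
  also have "\<dots> = (\<integral>\<^sup>+z. \<integral>\<^sup>+\<omega>. ennreal (f (Y \<omega> ** z - B ** c)) \<partial>M \<partial>distr M borel Z)"
    by (subst nn_integral_distr) simp_all
  also have "\<dots> \<le> (\<integral>\<^sup>+z. ennreal (m\<^sup>2 * f (z - c) + C * s * f z) \<partial>distr M borel Z)"
    by (intro nn_integral_mono inner)
  also have "\<dots> = (\<integral>\<^sup>+\<omega>. ennreal (m\<^sup>2 * f (Z \<omega> - c) + C * s * f (Z \<omega>)) \<partial>M)"
    by (subst nn_integral_distr) simp_all
  also have "\<dots> = ennreal (\<integral>\<omega>. m\<^sup>2 * f (Z \<omega> - c) + C * s * f (Z \<omega>) \<partial>M)"
    by (rule nn_integral_eq_integral) (use Z Zc C s0 f0 in \<open>simp_all add: f_def\<close>)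
  also have "(\<integral>\<omega>. m\<^sup>2 * f (Z \<omega> - c) + C * s * f (Z \<omega>) \<partial>M) = r"
    using Z Zc by (simp add: r_def f_def)
  finally have le: "(\<integral>\<^sup>+\<omega>. ennreal (f (Y \<omega> ** Z \<omega> - B ** c)) \<partial>M) \<le> ennreal r" .
  \<comment> \<open>The bound on the nonnegative integral is finite, so integrability comes out of
    the same computation.\<close>
  have int: "integrable M (\<lambda>\<omega>. f (Y \<omega> ** Z \<omega> - B ** c))"
    by (rule integrableI_nonneg) (use f0 le in \<open>auto simp: le_less_trans\<close>)
  then show ?int
    by (simp add: f_def B_def)
  have "ennreal (\<integral>\<omega>. f (Y \<omega> ** Z \<omega> - B ** c) \<partial>M) \<le> ennreal r"
    using le by (simp add: nn_integral_eq_integral[OF int] f0)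
  moreover have "r \<ge> 0"
    unfolding r_def using C s0 by (intro add_nonneg_nonneg mult_nonneg_nonneg Bochner_Integration.integral_nonneg f0) auto
  ultimately show ?le
    by (simp add: f_def B_def C_def r_def)
qed

text \<open>Nonnegativity of the variance gives the bound for \<open>X\<close> itself, and
  \<open>g\<close> lies below \<open>X\<close>.\<close>

lemma integral_le_sqrt_integral_power2:
  assumes "integrable M (\<lambda>\<omega>. (X \<omega>)\<^sup>2)" and "X \<in> borel_measurable M" and "\<And>\<omega>. 0 \<le> g \<omega> \<and> g \<omega> \<le> X \<omega>"
  shows "(\<integral>\<omega>. g \<omega> \<partial>M) \<le> sqrt (\<integral>\<omega>. (X \<omega>)\<^sup>2 \<partial>M)"
proof -
  have X: "integrable M X"
    using square_integrable_imp_integrable[OF assms(2,1)] .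
  have "(\<integral>\<omega>. g \<omega> \<partial>M) \<le> integral\<^sup>L M X"
    by (rule integral_mono'[OF X]) (use assms(3) order_trans in blast)+
  also have "0 \<le> variance X"
    by (rule variance_positive)
  then have "integral\<^sup>L M X \<le> sqrt (\<integral>\<omega>. (X \<omega>)\<^sup>2 \<partial>M)"
    unfolding variance_eq[OF X assms(1)] by (intro real_le_rsqrt) simp
  finally show ?thesis .
qed

end

text \<open>Each uncentred step multiplies the bound by
  \<open>m^2 (1 + (2k - 1) \<sigma>^2)\<close>. A centred step multiplies by \<open>m^2\<close> and
  adds \<open>(2k - 1) \<sigma>^2 m^2\<close> times the uncentred bound; \<open>q - 1\<close> solves
  this recursion, starting from 0. The dimension and the bounds \<open>m\<close> sit in
  \<open>R\<close>.\<close>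

lemma (in prob_space) left_prod_moments:
  fixes Y :: "nat \<Rightarrow> 'a \<Rightarrow> complex ^ 'd ^ 'd" and m \<sigma> :: "nat \<Rightarrow> real"
  defines "Z \<equiv> \<lambda>j \<omega>. left_prod (\<lambda>i. Y i \<omega>) j"
  assumes k: "k \<ge> 1" and indep: "indep_vars (\<lambda>_. borel) Y {1..n}"
    and Y: "\<And>i. i \<in> {1..n} \<Longrightarrow> integrable M (Y i)"
    and V: "\<And>i. i \<in> {1..n} \<Longrightarrow> integrable M (\<lambda>\<omega>. (spectral_norm (Y i \<omega> - integral\<^sup>L M (Y i)))\<^sup>2)"
    and m: "\<And>i. i \<in> {1..n} \<Longrightarrow> spectral_norm (integral\<^sup>L M (Y i)) \<le> m i"
    and s: "\<And>i. i \<in> {1..n} \<Longrightarrow>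
      (\<integral>\<omega>. (spectral_norm (Y i \<omega> - integral\<^sup>L M (Y i)))\<^sup>2 \<partial>M) \<le> (\<sigma> i * m i)\<^sup>2"
    and j: "j \<le> n"
  defines "q \<equiv> \<lambda>j. \<Prod>i = 1..j. 1 + (2 * real k - 1) * (\<sigma> i)\<^sup>2"
    and "R \<equiv> \<lambda>j. root k (real CARD('d)) * (\<Prod>i = 1..j. m i)\<^sup>2"
  shows "integrable M (Z j)"
    and "integrable M (\<lambda>\<omega>. (schatten k (Z j \<omega>))\<^sup>2)"
    and "(\<integral>\<omega>. (schatten k (Z j \<omega>))\<^sup>2 \<partial>M) \<le> R j * q j"
    and "integrable M (\<lambda>\<omega>. (schatten k (Z j \<omega> - integral\<^sup>L M (Z j)))\<^sup>2)"
    and "(\<integral>\<omega>. (schatten k (Z j \<omega> - integral\<^sup>L M (Z j)))\<^sup>2 \<partial>M) \<le> R j * (q j - 1)"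
proof -
  define F where "F = (\<lambda>X :: 'a \<Rightarrow> complex ^ 'd ^ 'd. \<integral>\<omega>. (schatten k (X \<omega>))\<^sup>2 \<partial>M)"
  define C where "C = 2 * real k - 1"
  have C: "C \<ge> 0"
    using k by (simp add: C_def)
  have "integrable M (Z j) \<and> integrable M (\<lambda>\<omega>. (schatten k (Z j \<omega>))\<^sup>2)
    \<and> F (Z j) \<le> R j * q j
    \<and> integrable M (\<lambda>\<omega>. (schatten k (Z j \<omega> - integral\<^sup>L M (Z j)))\<^sup>2)
    \<and> F (\<lambda>\<omega>. Z j \<omega> - integral\<^sup>L M (Z j)) \<le> R j * (q j - 1)"
    using j
  proof (induction j)
    case 0
    have "Z 0 = (\<lambda>_. mat 1)"
      by (simp add: Z_def)
    then show ?case
      using k by (simp add: F_def R_def q_def prob_space schatten_one schatten_eq_0_iff[THEN iffD2])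
  next
    case (Suc j)
    let ?i = "Suc j"
    have i: "?i \<in> {1..n}"
      using Suc.prems by simp
    have IH: "integrable M (Z j)" "integrable M (\<lambda>\<omega>. (schatten k (Z j \<omega>))\<^sup>2)" "F (Z j) \<le> R j * q j"
      "integrable M (\<lambda>\<omega>. (schatten k (Z j \<omega> - integral\<^sup>L M (Z j)))\<^sup>2)"
      "F (\<lambda>\<omega>. Z j \<omega> - integral\<^sup>L M (Z j)) \<le> R j * (q j - 1)"
      using Suc by auto
    have ind: "indep_var borel (Y ?i) borel (Z j)"
      unfolding Z_def by (rule indep_var_left_prod[OF indep]) (use Suc.prems in simp)
    have Z_Suc: "Z ?i = (\<lambda>\<omega>. Y ?i \<omega> ** Z j \<omega>)"
      by (simp add: Z_def)
    have EZ_Suc: "integral\<^sup>L M (Z ?i) = integral\<^sup>L M (Y ?i) ** integral\<^sup>L M (Z j)"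
      unfolding Z_Suc by (rule integral_matrix_mult[OF ind Y[OF i] IH(1)])
    note step = integrable_schatten_step[OF k ind Y[OF i] V[OF i] s[OF i] m[OF i] IH(2)]
      integral_schatten_step[OF k ind Y[OF i] V[OF i] s[OF i] m[OF i] IH(2)]
    have q_Suc: "q ?i = q j * (1 + C * (\<sigma> ?i)\<^sup>2)" and R_Suc: "R ?i = R j * (m ?i)\<^sup>2"
      by (simp_all add: q_def R_def C_def power_mult_distrib)
    \<comment> \<open>With \<open>c = 0\<close> both integrals in the step bound are the same
      uncentred moment.\<close>
    have "F (Z ?i) \<le> (m ?i)\<^sup>2 * F (Z j) + C * (\<sigma> ?i * m ?i)\<^sup>2 * F (Z j)"
      using step(2)[of 0] IH(2) by (simp add: F_def C_def Z_Suc)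
    also have "\<dots> \<le> (m ?i)\<^sup>2 * (R j * q j) + C * (\<sigma> ?i * m ?i)\<^sup>2 * (R j * q j)"
      using C by (intro add_mono mult_left_mono IH(3)) auto
    also have "\<dots> = R ?i * q ?i"
      by (simp add: q_Suc R_Suc algebra_simps power_mult_distrib)
    finally have 1: "F (Z ?i) \<le> R ?i * q ?i" .
    \<comment> \<open>Here \<open>c\<close> is the mean of \<open>Z j\<close>, and
      \<open>EZ_Suc\<close> identifies the new centre with the mean of \<open>Z ?i\<close>.\<close>
    have "F (\<lambda>\<omega>. Z ?i \<omega> - integral\<^sup>L M (Z ?i))
        \<le> (m ?i)\<^sup>2 * F (\<lambda>\<omega>. Z j \<omega> - integral\<^sup>L M (Z j)) + C * (\<sigma> ?i * m ?i)\<^sup>2 * F (Z j)"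
      using step(2)[OF IH(4)] unfolding EZ_Suc by (simp add: F_def C_def Z_Suc)
    also have "\<dots> \<le> (m ?i)\<^sup>2 * (R j * (q j - 1)) + C * (\<sigma> ?i * m ?i)\<^sup>2 * (R j * q j)"
      using C by (intro add_mono mult_left_mono IH(3,5)) auto
    also have "\<dots> = R ?i * (q ?i - 1)"
      by (simp add: q_Suc R_Suc algebra_simps power_mult_distrib)
    finally have 2: "F (\<lambda>\<omega>. Z ?i \<omega> - integral\<^sup>L M (Z ?i)) \<le> R ?i * (q ?i - 1)" .
    show ?case
      using 1 2 step(1)[of 0] step(1)[OF IH(4)] IH(2) integrable_matrix_mult[OF ind Y[OF i] IH(1)]
      unfolding EZ_Suc by (simp add: Z_Suc)
  qed
  then show "integrable M (Z j)"
    and "integrable M (\<lambda>\<omega>. (schatten k (Z j \<omega>))\<^sup>2)"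
    and "(\<integral>\<omega>. (schatten k (Z j \<omega>))\<^sup>2 \<partial>M) \<le> R j * q j"
    and "integrable M (\<lambda>\<omega>. (schatten k (Z j \<omega> - integral\<^sup>L M (Z j)))\<^sup>2)"
    and "(\<integral>\<omega>. (schatten k (Z j \<omega> - integral\<^sup>L M (Z j)))\<^sup>2 \<partial>M) \<le> R j * (q j - 1)"
    by (simp_all add: F_def)
qed

text \<open>The exponent \<open>2k\<close> is an even integer nearest to the real minimizer \<open>p = sqrt (2 * L / v)\<close>.  The
  rounding costs at most \<open>v * (2k - p)\<^sup>2 / (4k)\<close>, which the slack \<open>v / 2\<close> absorbs.\<close>
lemma exists_good_exponent:
  fixes v L :: real
  assumes v: "v > 0" and L: "L \<ge> 0"
  shows "\<exists>k::nat. k \<ge> 1 \<and> L / (2 * real k) + (2 * real k - 1) * v / 2 \<le> sqrt (2 * v * max (2 * v) L)"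
proof (cases "L \<ge> 2 * v")
  case True
  define p where "p = sqrt (2 * L / v)"
  have p2: "p\<^sup>2 = 2 * L / v"
    using v L by (simp add: p_def)
  have "sqrt 4 \<le> p"
    unfolding p_def using v True by (intro real_sqrt_le_mono) (simp add: field_simps)
  then have p: "p \<ge> 2"
    by simp
  define k where "k = nat (round (p / 2))"
  have round: "\<bar>of_int (round (p / 2)) - p / 2\<bar> \<le> 1 / 2"
    by (rule of_int_round_abs_le)
  then have "of_int (round (p / 2)) > (0::real)"
    using p by linarith
  then have "round (p / 2) \<ge> 1"
    by simp
  then have k: "k \<ge> 1" and rk: "real k = of_int (round (p / 2))"
    by (simp_all add: k_def)
  \<comment> \<open>The squared rounding error is at most 1 and hence at most \<open>2 * k\<close>;
    expanding the square and dividing by \<open>2 * k\<close> gives the bound.\<close>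
  have "\<bar>p - 2 * real k\<bar> \<le> 1"
    using round unfolding rk by linarith
  then have "(p - 2 * real k)\<^sup>2 \<le> 1"
    by (simp add: abs_square_le_1)
  also have "1 \<le> 2 * real k"
    using k by simp
  finally have "p\<^sup>2 + (2 * real k - 1) * (2 * real k) \<le> 2 * p * (2 * real k)"
    by (simp add: power2_eq_square algebra_simps)
  then have "(p\<^sup>2 + (2 * real k - 1) * (2 * real k)) / (2 * real k) \<le> 2 * p"
    using k by (subst pos_divide_le_eq) auto
  then have "p\<^sup>2 / (2 * real k) + (2 * real k - 1) \<le> 2 * p"
    using k by (simp add: add_divide_distrib)
  then have "(p\<^sup>2 / (2 * real k) + (2 * real k - 1)) * (v / 2) \<le> 2 * p * (v / 2)"
    using v by (intro mult_right_mono) auto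
  moreover have "L = p\<^sup>2 * v / 2"
    using v by (simp add: p2)
  then have "(p\<^sup>2 / (2 * real k) + (2 * real k - 1)) * (v / 2) = L / (2 * real k) + (2 * real k - 1) * v / 2"
    by (simp add: distrib_right)
  ultimately have "L / (2 * real k) + (2 * real k - 1) * v / 2 \<le> p * v"
    by simp
  also have "p * v = sqrt (p\<^sup>2 * v\<^sup>2)"
    using p v by (simp add: real_sqrt_mult)
  also have "p\<^sup>2 * v\<^sup>2 = 2 * v * max (2 * v) L"
    unfolding p2 using v True by (simp add: max_def power2_eq_square)
  finally show ?thesis
    using k by blast
next
  \<comment> \<open>The real minimizer is now below 2, and the smallest even exponent suffices:
    \<open>L / 2 + v / 2 < 2 * v\<close>.\<close>
  case False
  have "sqrt (2 * v * max (2 * v) L) = sqrt ((2 * v)\<^sup>2)"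
    using False by (simp add: max_def power2_eq_square)
  also have "\<dots> = 2 * v"
    using v by (simp only: real_sqrt_abs)
  finally show ?thesis
    using False v by (intro exI[of _ 1]) simp
qed

theorem corollary5p4:
  fixes P :: "'w measure"
    and n :: nat
    and Y :: "nat \<Rightarrow> 'w \<Rightarrow> complex ^ 'd ^ 'd"
    and Z :: "'w \<Rightarrow> complex ^ 'd ^ 'd"
    and m \<sigma> :: "nat \<Rightarrow> real"
    and M v :: real
  assumes "prob_space P"
    and "prob_space.indep_vars P (\<lambda>_. borel) Y {1..n}"
    and "\<And>i. i \<in> {1..n} \<Longrightarrow> integrable P (Y i)"
    and "\<And>i. i \<in> {1..n} \<Longrightarrow>
      integrable P (\<lambda>\<omega>. (spectral_norm (Y i \<omega> - integral\<^sup>L P (Y i)))\<^sup>2)"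
    and "\<And>i. i \<in> {1..n} \<Longrightarrow> spectral_norm (integral\<^sup>L P (Y i)) \<le> m i"
    and "\<And>i. i \<in> {1..n} \<Longrightarrow>
      sqrt (\<integral>\<omega>. (spectral_norm (Y i \<omega> - integral\<^sup>L P (Y i)))\<^sup>2 \<partial>P) \<le> \<sigma> i * m i"
    and "Z = (\<lambda>\<omega>. left_prod (\<lambda>i. Y i \<omega>) n)"
    and "M = (\<Prod>i = 1..n. m i)"
    and "v = (\<Sum>i = 1..n. (\<sigma> i)\<^sup>2)"
  shows "integrable P Z \<and>
    (\<integral>\<omega>. spectral_norm (Z \<omega>) \<partial>P)
      \<le> exp (sqrt (2 * v * max (2 * v) (ln (real CARD('d))))) * M \<and>
    (v * (1 + 2 * ln (real CARD('d))) \<le> 1 \<longrightarrow>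
      (\<integral>\<omega>. spectral_norm (Z \<omega> - integral\<^sup>L P Z) \<partial>P)
        \<le> sqrt ((exp 1)\<^sup>2 * v * (1 + 2 * ln (real CARD('d)))) * M)"
proof -
  interpret prob_space P
    by fact
  define L where "L = ln (real CARD('d))"
  have L: "L \<ge> 0"
    by (simp add: L_def)
  have m: "m i \<ge> 0" if "i \<in> {1..n}" for i
    using assms(5)[OF that] spectral_norm_nonneg[of "integral\<^sup>L P (Y i)"] by linarith
  have M: "M \<ge> 0"
    unfolding assms(8) by (intro prod_nonneg) (use m in auto)
  have v: "v \<ge> 0"
    unfolding assms(9) by (intro sum_nonneg) auto
  have s: "(\<integral>\<omega>. (spectral_norm (Y i \<omega> - integral\<^sup>L P (Y i)))\<^sup>2 \<partial>P) \<le> (\<sigma> i * m i)\<^sup>2"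
    if "i \<in> {1..n}" for i
    using assms(6)[OF that] by (rule sqrt_le_D)
  define q where "q = (\<lambda>k::nat. \<Prod>i = 1..n. 1 + (2 * real k - 1) * (\<sigma> i)\<^sup>2)"
  have moments: "integrable P Z"
    "integrable P (\<lambda>\<omega>. (schatten k (Z \<omega>))\<^sup>2)"
    "(\<integral>\<omega>. (schatten k (Z \<omega>))\<^sup>2 \<partial>P) \<le> root k (real CARD('d)) * M\<^sup>2 * q k"
    "integrable P (\<lambda>\<omega>. (schatten k (Z \<omega> - integral\<^sup>L P Z))\<^sup>2)"
    "(\<integral>\<omega>. (schatten k (Z \<omega> - integral\<^sup>L P Z))\<^sup>2 \<partial>P) \<le> root k (real CARD('d)) * M\<^sup>2 * (q k - 1)"
    if "k \<ge> 1" for k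
    unfolding assms(7,8) q_def
    by (rule left_prod_moments[OF that assms(2-5) s order_refl]; assumption)+
  have q: "q k \<le> exp ((2 * real k - 1) * v)" if "k \<ge> 1" for k
  proof -
    have "q k \<le> (\<Prod>i = 1..n. exp ((2 * real k - 1) * (\<sigma> i)\<^sup>2))"
      unfolding q_def using that
      by (intro prod_mono conjI exp_ge_add_one_self add_nonneg_nonneg mult_nonneg_nonneg) auto
    also have "\<dots> = exp ((2 * real k - 1) * v)"
      by (simp add: assms(9) exp_sum sum_distrib_left)
    finally show ?thesis .
  qed
  have root: "root k (real CARD('d)) = exp (L / real k)" if "k \<ge> 1" for k
    using that by (simp add: root_powr_inverse powr_def L_def field_simps)
  have Z: "integrable P Z"
    using moments(1)[of 1] by simp
  have meas: "(\<lambda>\<omega>. schatten k (Z \<omega> - c)) \<in> borel_measurable P" if "k \<ge> 1" for k c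
    using measurable_compose[OF _ measurable_schatten[OF that], of "\<lambda>\<omega>. Z \<omega> - c"] Z by auto
  \<comment> \<open>The bound for each exponent before optimization; the halves in the exponent come
    from the square root of the second moment.\<close>
  have growth: "(\<integral>\<omega>. spectral_norm (Z \<omega>) \<partial>P)
      \<le> exp (L / (2 * real k) + (2 * real k - 1) * v / 2) * M" if k: "k \<ge> 1" for k
  proof -
    have "(\<integral>\<omega>. spectral_norm (Z \<omega>) \<partial>P) \<le> sqrt (\<integral>\<omega>. (schatten k (Z \<omega>))\<^sup>2 \<partial>P)"
      using meas[OF k, of 0]
      by (intro integral_le_sqrt_integral_power2 moments(2)[OF k])
        (auto simp: spectral_norm_nonneg spectral_norm_le_schatten[OF k])
    also have "\<dots> \<le> sqrt (exp (L / real k) * M\<^sup>2 * q k)"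
      using moments(3)[OF k] by (simp add: root[OF k] q_def)
    also have "\<dots> \<le> sqrt (exp (L / real k) * M\<^sup>2 * exp ((2 * real k - 1) * v))"
      by (intro real_sqrt_le_mono mult_left_mono q k) auto
    also have "exp (L / real k) * M\<^sup>2 * exp ((2 * real k - 1) * v)
        = (exp (L / (2 * real k) + (2 * real k - 1) * v / 2) * M)\<^sup>2"
      by (simp add: power_mult_distrib exp_add flip: exp_double)
    finally show ?thesis
      using M by simp
  qed
  have first: "(\<integral>\<omega>. spectral_norm (Z \<omega>) \<partial>P) \<le> exp (sqrt (2 * v * max (2 * v) L)) * M"
  proof (cases "v = 0")
    case True
    \<comment> \<open>For \<open>v = 0\<close> a larger exponent only helps, and \<open>k\<close>
      tending to infinity removes the dimension factor.\<close>
    have "(\<lambda>k. exp (L / (2 * real k)) * M) \<longlonglongrightarrow> exp 0 * M"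
      by (intro tendsto_intros) real_asymp
    then have "(\<integral>\<omega>. spectral_norm (Z \<omega>) \<partial>P) \<le> exp 0 * M"
      by (rule LIMSEQ_le_const) (use growth True in auto)
    then show ?thesis
      using True by simp
  next
    case False
    then obtain k :: nat where k: "k \<ge> 1"
      "L / (2 * real k) + (2 * real k - 1) * v / 2 \<le> sqrt (2 * v * max (2 * v) L)"
      using exists_good_exponent[of v L] v L by auto
    show ?thesis
      by (rule order_trans[OF growth[OF k(1)]]) (use k M in \<open>auto intro: mult_right_mono\<close>)
  qed
  have second: "(\<integral>\<omega>. spectral_norm (Z \<omega> - integral\<^sup>L P Z) \<partial>P) \<le> sqrt ((exp 1)\<^sup>2 * v * (1 + 2 * L)) * M"
    if small: "v * (1 + 2 * L) \<le> 1"
  proof -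
    \<comment> \<open>The exponent \<open>2 * k\<close> just exceeds \<open>2 * L\<close>: the
      dimension factor \<open>exp (L / k)\<close> is then at most \<open>exp 1\<close>, while
      \<open>2 * k - 1 \<le> 1 + 2 * L\<close> keeps \<open>u \<le> 1\<close>.\<close>
    define k where "k = nat \<lfloor>L\<rfloor> + 1"
    define u where "u = (2 * real k - 1) * v"
    have k: "k \<ge> 1" "L \<le> real k" "real k \<le> L + 1"
      using L by (auto simp: k_def) linarith+
    have u0: "u \<ge> 0"
      using k(1) v by (simp add: u_def)
    have u1: "u \<le> v * (1 + 2 * L)"
      unfolding u_def using k(3) v by (subst mult.commute) (intro mult_left_mono, auto)
    \<comment> \<open>This yields \<open>exp u - 1 \<le> u * exp u\<close>, and
      \<open>u \<le> 1\<close> then supplies the second factor \<open>exp 1\<close> of the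
      constant.\<close>
    have "1 - u \<le> exp (- u)"
      using exp_ge_add_one_self[of "- u"] by simp
    then have "(1 - u) * exp u \<le> exp (- u) * exp u"
      by (intro mult_right_mono) auto
    then have "exp u - 1 \<le> u * exp u"
      by (simp add: algebra_simps flip: exp_add)
    also have "\<dots> \<le> v * (1 + 2 * L) * exp 1"
      using u0 u1 small by (intro mult_mono) auto
    finally have e: "exp u - 1 \<le> v * (1 + 2 * L) * exp 1" .
    have "(\<integral>\<omega>. spectral_norm (Z \<omega> - integral\<^sup>L P Z) \<partial>P)
        \<le> sqrt (\<integral>\<omega>. (schatten k (Z \<omega> - integral\<^sup>L P Z))\<^sup>2 \<partial>P)"
      by (intro integral_le_sqrt_integral_power2 moments(4)[OF k(1)] meas[OF k(1)])
        (auto simp: spectral_norm_nonneg spectral_norm_le_schatten[OF k(1)])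
    also have "\<dots> \<le> sqrt (exp (L / real k) * M\<^sup>2 * (q k - 1))"
      using moments(5)[OF k(1)] by (simp add: root[OF k(1)] q_def)
    also have "\<dots> \<le> sqrt (exp (L / real k) * M\<^sup>2 * (exp u - 1))"
      using q[OF k(1)] by (intro real_sqrt_le_mono mult_left_mono) (auto simp: u_def)
    also have "\<dots> \<le> sqrt (exp 1 * M\<^sup>2 * (v * (1 + 2 * L) * exp 1))"
      using k u0 by (intro real_sqrt_le_mono mult_mono e) auto
    also have "exp 1 * M\<^sup>2 * (v * (1 + 2 * L) * exp 1) = ((exp 1)\<^sup>2 * v * (1 + 2 * L)) * M\<^sup>2"
      by (simp add: power2_eq_square)
    also have "sqrt \<dots> = sqrt ((exp 1)\<^sup>2 * v * (1 + 2 * L)) * M"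
      unfolding real_sqrt_mult[of _ "M\<^sup>2"] using M by simp
    finally show ?thesis .
  qed
  show ?thesis
    using Z first second unfolding L_def by simp
qed

end
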